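(* Let $c(x)=\Big(\dfrac{|x|^2}{1+|x|^2}\Big)^{1/2}$ for $x\in\mathbb{R}$, and let $H_0$ be the viscosity operator on $L_2(\mathbb{R})$ with coefficient $c$ and $d_C$ the associated distance. Then for all $x\in\mathbb{R}$ there is an $a>0$ such that $d_C(x;y)\le a\,|x-y|^{1/2}$ for all $y\in\mathbb{R}$ with $|x-y|<1$, but $H_0$ is not subelliptic of order $1/2$.
   Context: For a real-valued $c\in L_\infty(\mathbb{R})$ with $c\ge0$ a.e. and $\varepsilon\in(0,1]$, let $H_\varepsilon$ be the positive self-adjoint operator on $L_2(\mathbb{R})$ associated with the closed form $h_\varepsilon(\varphi)=\int_{\mathbb{R}}(c+\varepsilon)|\varphi'|^2$ with domain $W^{1,2}(\mathbb{R})$. As $\varepsilon\downarrow0$, $H_\varepsilon$ converges in the strong resolvent sense to a positive self-adjoint operator $H_0$, the viscosity operator with coefficient $c$. The distance is $d_C(x;y)=\sup\{|\psi(x)-\psi(y)|:\psi\in C_c^\infty(\mathbb{R})\text{ real},\ \|c\,(\psi')^2\|_\infty\le1\}\in[0,\infty]$. With $\Delta=-d^2/dx^2$ the positive self-adjoint Laplacian on $L_2(\mathbb{R})$, $H_0$ is called subelliptic of order $\gamma\in(0,1]$ if there exist $\mu>0$, $\nu\ge0$ such that $D(H_0^{1/2})\subseteq D(\Delta^{\gamma/2})$ and $\|H_0^{1/2}\varphi\|_2^2+\nu\|\varphi\|_2^2\ge\mu\|\Delta^{\gamma/2}\varphi\|_2^2$ for all $\varphi\in D(H_0^{1/2})$.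 *)

theory Defs
  imports "HOL-Analysis.Analysis"
begin

section \<open>The complex Hilbert space \<open>L\<^sub>2(\<real>)\<close>\<close>

text \<open>Borel representatives suffice, since every Lebesgue measurable function agrees
  almost everywhere with a Borel measurable one.\<close>

definition square_integrable :: "(real \<Rightarrow> complex) \<Rightarrow> bool" where
  "square_integrable f \<longleftrightarrow>
     f \<in> borel_measurable lborel \<and> integrable lborel (\<lambda>x. (cmod (f x))\<^sup>2)"

definition L2_eq :: "(real \<Rightarrow> complex) \<Rightarrow> (real \<Rightarrow> complex) \<Rightarrow> bool" where
  "L2_eq f g \<longleftrightarrow> square_integrable f \<and> square_integrable g \<and> (AE x in lborel. f x = g x)"

lemma square_integrable_zero: "square_integrable (\<lambda>x. 0)"
  by (simp add: square_integrable_def)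

lemma square_integrable_add:
  assumes "square_integrable f" "square_integrable g"
  shows "square_integrable (\<lambda>x. f x + g x)"
proof -
  have [measurable]: "f \<in> borel_measurable lborel" "g \<in> borel_measurable lborel"
    using assms by (auto simp: square_integrable_def)
  have i: "integrable lborel (\<lambda>x. 2 * (cmod (f x))\<^sup>2 + 2 * (cmod (g x))\<^sup>2)"
    using assms by (auto simp: square_integrable_def)
  have "(cmod (f x + g x))\<^sup>2 \<le> 2 * (cmod (f x))\<^sup>2 + 2 * (cmod (g x))\<^sup>2" for x
  proof -
    have "(cmod (f x + g x))\<^sup>2 \<le> (cmod (f x) + cmod (g x))\<^sup>2"
      by (intro power_mono norm_triangle_ineq) auto
    also have "\<dots> \<le> 2 * (cmod (f x))\<^sup>2 + 2 * (cmod (g x))\<^sup>2"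
      using sum_squares_bound[of "cmod (f x)" "cmod (g x)"] by (simp add: power2_sum)
    finally show ?thesis .
  qed
  then have "integrable lborel (\<lambda>x. (cmod (f x + g x))\<^sup>2)"
    by (intro Bochner_Integration.integrable_bound[OF i]) auto
  then show ?thesis by (simp add: square_integrable_def)
qed

lemma square_integrable_mult:
  assumes "square_integrable f"
  shows "square_integrable (\<lambda>x. a * f x)"
  using assms by (auto simp: square_integrable_def norm_mult power_mult_distrib)

lemma integrable_mult_cnj:
  assumes "square_integrable f" "square_integrable g"
  shows "integrable lborel (\<lambda>x. f x * cnj (g x))"
proof -
  have [measurable]: "f \<in> borel_measurable lborel" "g \<in> borel_measurable lborel"
    using assms by (auto simp: square_integrable_def)
  have [measurable]: "cnj \<in> borel_measurable borel"
    by (intro borel_measurable_continuous_onI continuous_intros)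
  have i: "integrable lborel (\<lambda>x. (cmod (f x))\<^sup>2 + (cmod (g x))\<^sup>2)"
    using assms by (auto simp: square_integrable_def)
  have "cmod (f x) * cmod (g x) \<le> (cmod (f x))\<^sup>2 + (cmod (g x))\<^sup>2" for x
    using sum_squares_bound[of "cmod (f x)" "cmod (g x)"]
          mult_nonneg_nonneg[OF norm_ge_zero[of "f x"] norm_ge_zero[of "g x"]]
    unfolding mult.assoc by linarith
  then show ?thesis
    by (intro Bochner_Integration.integrable_bound[OF i]) (auto simp: norm_mult)
qed

quotient_type L2 = "real \<Rightarrow> complex" / partial: L2_eq
proof (rule part_equivpI)
  show "\<exists>f. L2_eq f f"
    using square_integrable_zero by (auto simp: L2_eq_def)
  show "symp L2_eq"
    by (auto simp: symp_def L2_eq_def)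
  show "transp L2_eq"
    by (auto simp: transp_def L2_eq_def)
qed

lift_definition cscale :: "complex \<Rightarrow> L2 \<Rightarrow> L2" is "\<lambda>a f x. a * f x"
  by (auto simp: L2_eq_def square_integrable_mult)

lift_definition cinner :: "L2 \<Rightarrow> L2 \<Rightarrow> complex" is "\<lambda>f g. LINT x|lborel. f x * cnj (g x)"
proof -
  fix f f' g g' assume "L2_eq f f'" "L2_eq g g'"
  then show "(LINT x|lborel. f x * cnj (g x)) = (LINT x|lborel. f' x * cnj (g' x))"
    by (intro integral_cong_AE borel_measurable_integrable integrable_mult_cnj)
       (auto simp: L2_eq_def)
qed

instantiation L2 :: real_vector
begin

lift_definition zero_L2 :: L2 is "\<lambda>x. 0"
  by (simp add: L2_eq_def square_integrable_zero)

lift_definition plus_L2 :: "L2 \<Rightarrow> L2 \<Rightarrow> L2" is "\<lambda>f g x. f x + g x"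
  by (auto simp: L2_eq_def square_integrable_add)

lift_definition uminus_L2 :: "L2 \<Rightarrow> L2" is "\<lambda>f x. - f x"
  by (auto simp: L2_eq_def square_integrable_def)

definition minus_L2 :: "L2 \<Rightarrow> L2 \<Rightarrow> L2" where "minus_L2 u v = u + - v"

definition scaleR_L2 :: "real \<Rightarrow> L2 \<Rightarrow> L2" where "scaleR_L2 r u = cscale (complex_of_real r) u"

instance
proof
  fix u v w :: L2 and a b :: real
  show "u + v + w = u + (v + w)"
    by transfer (auto simp: L2_eq_def add.assoc intro!: square_integrable_add)
  show "u + v = v + u"
    by transfer (auto simp: L2_eq_def add.commute intro!: square_integrable_add)
  show "0 + u = u"
    by transfer (auto simp: L2_eq_def)
  show "- u + u = 0"
    by transfer (auto simp: L2_eq_def square_integrable_zero)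
  show "u - v = u + - v"
    by (rule minus_L2_def)
  show "a *\<^sub>R (u + v) = a *\<^sub>R u + a *\<^sub>R v"
    unfolding scaleR_L2_def
    by transfer (auto simp: L2_eq_def ring_distribs
        intro!: square_integrable_add square_integrable_mult)
  show "(a + b) *\<^sub>R u = a *\<^sub>R u + b *\<^sub>R u"
    unfolding scaleR_L2_def
    by transfer (auto simp: L2_eq_def ring_distribs
        intro!: square_integrable_add square_integrable_mult)
  show "a *\<^sub>R b *\<^sub>R u = (a * b) *\<^sub>R u"
    unfolding scaleR_L2_def
    by transfer (auto simp: L2_eq_def mult.assoc intro!: square_integrable_mult)
  show "1 *\<^sub>R u = u"
    unfolding scaleR_L2_def by transfer (auto simp: L2_eq_def)
qed

end

lemma cinner_add_left: "cinner (u + v) w = cinner u w + cinner v w"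
  by transfer (auto simp: L2_eq_def ring_distribs integrable_mult_cnj)

lemma cinner_cscale_left: "cinner (cscale a u) v = a * cinner u v"
  by transfer (simp add: mult.assoc)

lemma cinner_commute: "cinner u v = cnj (cinner v u)"
  by transfer (simp add: mult.commute flip: Bochner_Integration.integral_cnj)

lemma cinner_self:
  "\<exists>r\<ge>0. cinner u u = complex_of_real r \<and> (r = 0 \<longleftrightarrow> u = 0)"
proof transfer
  fix f assume f: "L2_eq f f"
  define r where "r = (LINT x|lborel. (cmod (f x))\<^sup>2)"
  have eq: "(LINT x|lborel. f x * cnj (f x)) = complex_of_real r"
    unfolding r_def by (simp add: complex_norm_square[symmetric] flip: integral_of_real of_real_power)
  have m: "f \<in> borel_measurable lborel"
    using f by (simp add: L2_eq_def square_integrable_def)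
  have "r = 0 \<longleftrightarrow> (AE x in lborel. (cmod (f x))\<^sup>2 = 0)"
    unfolding r_def using f
    by (intro integral_nonneg_eq_0_iff_AE) (auto simp: L2_eq_def square_integrable_def)
  then have "r = 0 \<longleftrightarrow> L2_eq f (\<lambda>x. 0)"
    using f by (auto simp: L2_eq_def square_integrable_zero)
  moreover have "r \<ge> 0"
    unfolding r_def by simp
  ultimately show
    "\<exists>r\<ge>0. (LINT x|lborel. f x * cnj (f x)) = complex_of_real r \<and> (r = 0 \<longleftrightarrow> L2_eq f (\<lambda>x. 0))"
    using eq by blast
qed

instantiation L2 :: real_inner
begin

definition inner_L2 :: "L2 \<Rightarrow> L2 \<Rightarrow> real" where "inner_L2 u v = Re (cinner u v)"

definition norm_L2 :: "L2 \<Rightarrow> real" where "norm_L2 u = sqrt (inner u u)"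

definition dist_L2 :: "L2 \<Rightarrow> L2 \<Rightarrow> real" where "dist_L2 u v = norm (u - v)"

definition sgn_L2 :: "L2 \<Rightarrow> L2" where "sgn_L2 u = u /\<^sub>R norm u"

definition uniformity_L2 :: "(L2 \<times> L2) filter" where
  "uniformity_L2 = (INF e\<in>{0 <..}. principal {(u, v). dist u v < e})"

definition open_L2 :: "L2 set \<Rightarrow> bool" where
  "open_L2 U \<longleftrightarrow> (\<forall>x\<in>U. eventually (\<lambda>(x', y). x' = x \<longrightarrow> y \<in> U) uniformity)"

instance
proof
  fix u v w :: L2 and r :: real
  show "dist u v = norm (u - v)" by (rule dist_L2_def)
  show "sgn u = u /\<^sub>R norm u" by (rule sgn_L2_def)
  show "(uniformity :: (L2 \<times> L2) filter) = (INF e\<in>{0 <..}. principal {(u, v). dist u v < e})"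
    by (rule uniformity_L2_def)
  show "open U \<longleftrightarrow> (\<forall>x\<in>U. eventually (\<lambda>(x', y). x' = x \<longrightarrow> y \<in> U) uniformity)" for U :: "L2 set"
    by (rule open_L2_def)
  show "inner u v = inner v u"
    unfolding inner_L2_def by (subst cinner_commute) simp
  show "inner (u + v) w = inner u w + inner v w"
    by (simp add: inner_L2_def cinner_add_left)
  show "inner (r *\<^sub>R u) v = r * inner u v"
    by (simp add: inner_L2_def scaleR_L2_def cinner_cscale_left)
  show "0 \<le> inner u u"
    unfolding inner_L2_def using cinner_self[of u] by auto
  show "inner u u = 0 \<longleftrightarrow> u = 0"
    unfolding inner_L2_def using cinner_self[of u] by auto
  show "norm u = sqrt (inner u u)"
    by (rule norm_L2_def)
qed

end

section \<open>Unbounded operators and forms\<close>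

text \<open>An operator is identified with its graph, so its domain is \<^const>\<open>Domain\<close>.\<close>

type_synonym oper = "(L2 \<times> L2) set"

definition linear_oper :: "oper \<Rightarrow> bool" where
  "linear_oper A \<longleftrightarrow> single_valued A \<and> (0, 0) \<in> A
     \<and> (\<forall>u f v g. (u, f) \<in> A \<longrightarrow> (v, g) \<in> A \<longrightarrow> (u + v, f + g) \<in> A)
     \<and> (\<forall>a u f. (u, f) \<in> A \<longrightarrow> (cscale a u, cscale a f) \<in> A)"

definition adjoint_oper :: "oper \<Rightarrow> oper" where
  "adjoint_oper A = {(v, g). \<forall>(u, f) \<in> A. cinner f v = cinner u g}"

definition positive_self_adjoint :: "oper \<Rightarrow> bool" where
  "positive_self_adjoint A \<longleftrightarrow> linear_oper A \<and> closure (Domain A) = UNIV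
     \<and> adjoint_oper A = A \<and> (\<forall>(u, f) \<in> A. 0 \<le> Re (cinner f u))"

text \<open>The operator of the first representation theorem for a closed form \<open>h\<close> with domain \<open>D\<close>:
  \<open>A u = f\<close> iff \<open>u \<in> D\<close> and \<open>h(u, v) = (f, v)\<close> for all \<open>v \<in> D\<close>.\<close>

definition form_oper :: "L2 set \<Rightarrow> (L2 \<Rightarrow> L2 \<Rightarrow> complex) \<Rightarrow> oper" where
  "form_oper D h = {(u, f). u \<in> D \<and> (\<forall>v\<in>D. h u v = cinner f v)}"

text \<open>\<open>R\<close> is the everywhere defined inverse of \<open>s I + A\<close>.\<close>

definition is_resolvent :: "oper \<Rightarrow> real \<Rightarrow> (L2 \<Rightarrow> L2) \<Rightarrow> bool" where
  "is_resolvent A s R \<longleftrightarrow> (\<forall>f u. (u, f - s *\<^sub>R u) \<in> A \<longleftrightarrow> u = R f)"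

definition strong_resolvent_limit :: "(real \<Rightarrow> oper) \<Rightarrow> oper \<Rightarrow> bool" where
  "strong_resolvent_limit A B \<longleftrightarrow>
     (\<forall>s>0. \<exists>R S. (\<forall>\<epsilon>\<in>{0<..1}. is_resolvent (A \<epsilon>) s (R \<epsilon>)) \<and> is_resolvent B s S \<and>
        (\<forall>f. ((\<lambda>\<epsilon>. R \<epsilon> f) \<longlongrightarrow> S f) (at_right 0)))"

section \<open>Spectral calculus\<close>

definition projection_valued_measure :: "(real set \<Rightarrow> L2 \<Rightarrow> L2) \<Rightarrow> bool" where
  "projection_valued_measure E \<longleftrightarrow>
     (\<forall>B\<in>sets borel. (\<forall>u v. E B (u + v) = E B u + E B v) \<and> (\<forall>a u. E B (cscale a u) = cscale a (E B u))
        \<and> (\<forall>u. E B (E B u) = E B u) \<and> (\<forall>u v. cinner (E B u) v = cinner u (E B v)))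
     \<and> (\<forall>u. E UNIV u = u)
     \<and> (\<forall>B :: nat \<Rightarrow> real set. range B \<subseteq> sets borel \<longrightarrow> disjoint_family B \<longrightarrow>
          (\<forall>u. (\<lambda>n. E (B n) u) sums E (\<Union>n. B n) u))"

definition scalar_spectral_measure :: "(real set \<Rightarrow> L2 \<Rightarrow> L2) \<Rightarrow> L2 \<Rightarrow> real measure" where
  "scalar_spectral_measure E u =
     measure_of UNIV (sets borel) (\<lambda>B. ennreal ((norm (E B u))\<^sup>2))"

text \<open>\<open>T\<close> is the operator \<open>\<integral> F dE\<close>: it has domain \<open>{u. \<integral> F\<^sup>2 d(E u, u) < \<infinity>}\<close> and
  \<open>(T u, u) = \<integral> F d(E u, u)\<close> there. Being linear, it is determined by polarization.\<close>

definition is_spectral_integral :: "(real set \<Rightarrow> L2 \<Rightarrow> L2) \<Rightarrow> (real \<Rightarrow> real) \<Rightarrow> oper \<Rightarrow> bool" where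
  "is_spectral_integral E F T \<longleftrightarrow> linear_oper T
     \<and> Domain T = {u. (\<integral>\<^sup>+t. ennreal ((F t)\<^sup>2) \<partial>scalar_spectral_measure E u) < \<infinity>}
     \<and> (\<forall>(u, w) \<in> T. cinner w u = complex_of_real (LINT t|scalar_spectral_measure E u. F t))"

text \<open>\<open>T = A\<^sup>\<alpha>\<close> for a positive self-adjoint \<open>A\<close> and \<open>\<alpha> > 0\<close>. The values of \<open>t powr \<alpha>\<close>
  for \<open>t < 0\<close> are irrelevant, since the spectral measure of such an \<open>A\<close> vanishes on \<open>{..<0}\<close>.\<close>

definition is_oper_power :: "oper \<Rightarrow> real \<Rightarrow> oper \<Rightarrow> bool" where
  "is_oper_power A \<alpha> T \<longleftrightarrow> (\<exists>E. projection_valued_measure E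
     \<and> is_spectral_integral E (\<lambda>t. t) A \<and> is_spectral_integral E (\<lambda>t. t powr \<alpha>) T)"

section \<open>Sobolev space, viscosity operator, Laplacian\<close>

definition test_fun :: "(real \<Rightarrow> real) \<Rightarrow> bool" where
  "test_fun \<psi> \<longleftrightarrow> (\<forall>n x. (deriv ^^ n) \<psi> differentiable at x) \<and> compact (closure {x. \<psi> x \<noteq> 0})"

definition has_weak_deriv :: "L2 \<Rightarrow> L2 \<Rightarrow> bool" where
  "has_weak_deriv u w \<longleftrightarrow> (\<forall>\<eta>. test_fun \<eta> \<longrightarrow>
     (LINT x|lborel. rep_L2 u x * of_real (deriv \<eta> x)) = - (LINT x|lborel. rep_L2 w x * of_real (\<eta> x)))"

text \<open>Real test functions suffice by linearity, and weak derivatives are unique in \<open>L\<^sub>2\<close>.\<close>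

definition W12 :: "L2 set" where
  "W12 = {u. \<exists>w. has_weak_deriv u w}"

definition weak_deriv :: "L2 \<Rightarrow> L2" where
  "weak_deriv u = (THE w. has_weak_deriv u w)"

text \<open>The sesquilinear form belonging to \<open>\<phi> \<mapsto> \<integral> a |\<phi>'|\<^sup>2\<close>.\<close>

definition energy_form :: "(real \<Rightarrow> real) \<Rightarrow> L2 \<Rightarrow> L2 \<Rightarrow> complex" where
  "energy_form a u v =
     (LINT x|lborel. of_real (a x) * rep_L2 (weak_deriv u) x * cnj (rep_L2 (weak_deriv v) x))"

definition is_viscosity_oper :: "(real \<Rightarrow> real) \<Rightarrow> oper \<Rightarrow> bool" where
  "is_viscosity_oper c H \<longleftrightarrow> positive_self_adjoint H
     \<and> strong_resolvent_limit (\<lambda>\<epsilon>. form_oper W12 (energy_form (\<lambda>x. c x + \<epsilon>))) H"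

definition Laplacian :: oper where
  "Laplacian = {(u, f). \<exists>w. has_weak_deriv u w \<and> has_weak_deriv w (- f)}"

text \<open>By the spectral theorem \<open>S = H\<^bsup>1/2\<^esup>\<close> and \<open>T = \<Delta>\<^bsup>\<gamma>/2\<^esup>\<close> exist and are unique
  for positive self-adjoint \<open>H\<close>, so the quantifier over \<open>S\<close> and \<open>T\<close> only names them.\<close>

definition subelliptic :: "real \<Rightarrow> oper \<Rightarrow> bool" where
  "subelliptic \<gamma> H \<longleftrightarrow> (\<exists>S T. is_oper_power H (1/2) S \<and> is_oper_power Laplacian (\<gamma>/2) T
     \<and> Domain S \<subseteq> Domain T
     \<and> (\<exists>\<mu> \<nu>. \<mu> > 0 \<and> \<nu> \<ge> 0 \<and> (\<forall>u f g. (u, f) \<in> S \<longrightarrow> (u, g) \<in> T \<longrightarrow>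
          (norm f)\<^sup>2 + \<nu> * (norm u)\<^sup>2 \<ge> \<mu> * (norm g)\<^sup>2)))"

section \<open>The distance\<close>

definition d_C :: "(real \<Rightarrow> real) \<Rightarrow> real \<Rightarrow> real \<Rightarrow> ennreal" where
  "d_C c x y = (SUP \<psi> \<in> {\<psi>. test_fun \<psi> \<and> (AE t in lborel. \<bar>c t * (deriv \<psi> t)\<^sup>2\<bar> \<le> 1)}.
     ennreal \<bar>\<psi> x - \<psi> y\<bar>)"

end

theory Submission
  imports Defs
begin

text \<open>Near \<open>0\<close> the coefficient behaves like \<open>|x|\<close>, so \<open>\<psi>'\<close> is dominated by \<open>|x|\<^bsup>-1/2\<^esup>\<close> for every \<open>\<psi>\<close> admitted in the
  distance, and integration gives the Hoelder bound. On the other hand \<open>1/c\<close> is not integrable at \<open>0\<close>, so a jump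
  there costs only finite energy: \<open>w = e\<^bsup>-x\<^esup> 1\<^bsub>x>0\<^esub>\<close> is the \<open>L\<^sub>2\<close> limit of \<open>e\<^bsup>-x\<^esup> 1\<^bsub>x>0\<^esub> - e\<^bsup>-nx\<^esup> 1\<^bsub>x>0\<^esub>\<close>, whose
  energies stay below \<open>4\<close>, and the resolvents of the viscosity operator turn these functions into elements
  \<open>v\<^sub>n\<close> of its domain with \<open>(H\<^sub>0 v\<^sub>n, v\<^sub>n) \<le> 4\<close> and the same limit. Subellipticity of order \<open>1/2\<close> would bound
  \<open>\<Delta>\<^bsup>1/4\<^esup> v\<^sub>n\<close> and hence \<open>\<integral> |t|\<^bsup>1/2\<^esup> d(E w, w)\<close> for the spectral family \<open>E\<close> of \<open>\<Delta>\<close>. But the explicit resolvent gives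
  \<open>(\<Delta> (\<Delta> + k\<^sup>2)\<^sup>-\<^sup>1 w, w) = 1 / (2 (1 + k))\<close>, which makes that integral diverge logarithmically. Taking \<open>k\<^sup>2\<close>
  purely imaginary avoids any appeal to the positivity of \<open>\<Delta>\<close>: for real \<open>t < 0\<close>, \<open>t powr \<alpha>\<close> is \<open>|t| powr \<alpha>\<close>.\<close>

section \<open>Inner products on \<open>L\<^sub>2(\<real>)\<close>\<close>

lemma cinner_add_right: "cinner w (u + v) = cinner w u + cinner w v"
  by (metis cinner_add_left cinner_commute complex_cnj_add)

lemma cinner_cscale_right: "cinner u (cscale a v) = cnj a * cinner u v"
  by (metis cinner_commute cinner_cscale_left complex_cnj_mult)

lemma cinner_minus_left: "cinner (- u) v = - cinner u v"
  by transfer simp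

lemma cinner_minus_right: "cinner u (- v) = - cinner u v"
  by (metis cinner_commute cinner_minus_left complex_cnj_minus)

lemma cinner_diff_left: "cinner (u - v) w = cinner u w - cinner v w"
  by (simp only: minus_L2_def cinner_add_left cinner_minus_left diff_conv_add_uminus)

lemma cinner_diff_right: "cinner u (v - w) = cinner u v - cinner u w"
  by (simp only: minus_L2_def cinner_add_right cinner_minus_right diff_conv_add_uminus)

lemma cinner_zero_left [simp]: "cinner 0 v = 0"
  using cinner_diff_left[of 0 0 v] by simp

lemma cinner_zero_right [simp]: "cinner v 0 = 0"
  using cinner_diff_right[of v 0 0] by simp

lemma cinner_scaleR_left: "cinner (r *\<^sub>R u) v = of_real r * cinner u v"
  by (simp add: scaleR_L2_def cinner_cscale_left)

lemma cinner_scaleR_right: "cinner u (r *\<^sub>R v) = of_real r * cinner u v"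
  by (simp add: scaleR_L2_def cinner_cscale_right)

lemmas cinner_simps = cinner_add_left cinner_add_right cinner_cscale_left cinner_cscale_right
  cinner_minus_left cinner_minus_right cinner_diff_left cinner_diff_right
  cinner_scaleR_left cinner_scaleR_right

lemma cinner_same: "cinner u u = of_real ((norm u)\<^sup>2)"
proof -
  obtain r where "cinner u u = of_real r" using cinner_self[of u] by blast
  then show ?thesis by (simp add: power2_norm_eq_inner inner_L2_def)
qed

text \<open>Reduces an identity between combinations of \<open>cscale\<close> to one between complex
  scalars, which \<open>cinner_simps\<close> can expand.\<close>

lemma L2_eqI:
  assumes "\<And>v. cinner u v = cinner u' v"
  shows "u = u'"
proof -
  have "inner (u - u') (u - u') = 0"
    using assms[of "u - u'"] by (simp add: inner_L2_def cinner_diff_left)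
  then show ?thesis by simp
qed

lemma cscale_of_real: "cscale (of_real r) u = r *\<^sub>R u"
  by (simp add: scaleR_L2_def)

lemma norm_cscale: "norm (cscale a u) = cmod a * norm u"
proof -
  have "cinner (cscale a u) (cscale a u) = (a * cnj a) * cinner u u"
    by (simp add: cinner_cscale_left cinner_cscale_right mult.assoc)
  then have "complex_of_real ((norm (cscale a u))\<^sup>2) = of_real ((cmod a * norm u)\<^sup>2)"
    by (simp only: cinner_same complex_norm_square[symmetric] power_mult_distrib of_real_mult)
  then have "(norm (cscale a u))\<^sup>2 = (cmod a * norm u)\<^sup>2"
    using of_real_eq_iff by blast
  then show ?thesis by simp
qed

text \<open>Multiplying \<open>u\<close> by the unimodular \<open>?a\<close> makes the product real
  and nonnegative; what remains is the Cauchy-Schwarz inequality of the real inner product.\<close>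

lemma norm_cinner_le: "cmod (cinner u v) \<le> norm u * norm v"
proof (cases "cinner u v = 0")
  case False
  let ?z = "cinner u v"
  let ?a = "cnj ?z / of_real (cmod ?z)"
  have a: "cmod ?a = 1" using False by (simp add: norm_divide)
  have "?a * ?z = of_real (cmod ?z)"
    using False complex_norm_square[of ?z] by (simp add: power2_eq_square field_simps)
  then have "cmod ?z = inner (cscale ?a u) v"
    by (simp add: inner_L2_def cinner_cscale_left)
  also have "\<dots> \<le> norm (cscale ?a u) * norm v" by (rule norm_cauchy_schwarz)
  finally show ?thesis using a by (simp add: norm_cscale)
qed simp

lemma bounded_linear_cinner_left: "bounded_linear (\<lambda>u. cinner u v)"
  by (rule bounded_linear_intro[where K = "norm v"])
     (simp_all add: cinner_simps norm_cinner_le scaleR_conv_of_real)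

text \<open>Here \<open>f\<close> and \<open>h\<close> stand for the images of \<open>u\<close> and \<open>f\<close> under a symmetric operator with numerical range in
  \<open>[-M, M]\<close>; polarize with \<open>u \<plusminus> f / M\<close>.\<close>

lemma numerical_range_norm_le:
  fixes u f h :: "'a::real_inner"
  assumes "M > 0" "inner h u = inner f f"
    and "\<And>r. \<bar>inner (f + r *\<^sub>R h) (u + r *\<^sub>R f)\<bar> \<le> M * (norm (u + r *\<^sub>R f))\<^sup>2"
  shows "norm f \<le> M * norm u"
proof -
  have n: "(norm (u + r *\<^sub>R f))\<^sup>2 = (norm u)\<^sup>2 + 2 * r * inner u f + r\<^sup>2 * (norm f)\<^sup>2" for r
    unfolding power2_norm_eq_inner inner_add_left inner_add_right inner_scaleR_left inner_scaleR_right
      inner_commute[of f u] power2_eq_square[of r]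
    by (simp only: algebra_simps mult_2)
  have i: "inner (f + r *\<^sub>R h) (u + r *\<^sub>R f)
      = inner f u + 2 * r * (norm f)\<^sup>2 + r\<^sup>2 * inner h f" for r
    unfolding power2_norm_eq_inner inner_add_left inner_add_right inner_scaleR_left inner_scaleR_right
      assms(2) power2_eq_square[of r]
    by (simp only: algebra_simps mult_2)
  have 1: "inner f u + 2 / M * (norm f)\<^sup>2 + (1 / M)\<^sup>2 * inner h f
      \<le> M * ((norm u)\<^sup>2 + 2 / M * inner u f + (1 / M)\<^sup>2 * (norm f)\<^sup>2)"
    using assms(3)[of "1/M"] unfolding n i by simp
  have 2: "- (inner f u - 2 / M * (norm f)\<^sup>2 + (1 / M)\<^sup>2 * inner h f)
      \<le> M * ((norm u)\<^sup>2 - 2 / M * inner u f + (1 / M)\<^sup>2 * (norm f)\<^sup>2)"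
    using assms(3)[of "-1/M"] unfolding n i by simp
  \<comment> \<open>Adding the two bounds cancels the terms in \<open>inner f u\<close>,
    \<open>inner u f\<close> and \<open>inner h f\<close>; only squared norms survive.\<close>
  have "4 / M * (norm f)\<^sup>2 \<le> 2 * M * (norm u)\<^sup>2 + 2 * M * (1 / M)\<^sup>2 * (norm f)\<^sup>2"
    using 1 2 unfolding distrib_left right_diff_distrib by (simp add: algebra_simps)
  moreover have "2 * M * (1 / M)\<^sup>2 = 2 / M"
    using assms(1) by (simp add: power2_eq_square)
  ultimately have "M / 2 * (2 / M * (norm f)\<^sup>2) \<le> M / 2 * (2 * M * (norm u)\<^sup>2)"
    using assms(1) by (intro mult_left_mono) auto
  moreover have "M / 2 * (2 / M * (norm f)\<^sup>2) = (norm f)\<^sup>2"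
    using assms(1) by simp
  moreover have "M / 2 * (2 * M * (norm u)\<^sup>2) = (M * norm u)\<^sup>2"
    by (simp add: power_mult_distrib power2_eq_square)
  ultimately have "(norm f)\<^sup>2 \<le> (M * norm u)\<^sup>2" by simp
  then show ?thesis
    by (rule power2_le_imp_le) (use assms(1) in simp)
qed

section \<open>Projection-valued measures and spectral integrals\<close>

locale pvm =
  fixes E :: "real set \<Rightarrow> L2 \<Rightarrow> L2"
  assumes pvm: "projection_valued_measure E"
begin

lemma E_add: "B \<in> sets borel \<Longrightarrow> E B (u + v) = E B u + E B v"
  and E_cscale: "B \<in> sets borel \<Longrightarrow> E B (cscale a u) = cscale a (E B u)"
  and E_idem: "B \<in> sets borel \<Longrightarrow> E B (E B u) = E B u"
  and E_sym: "B \<in> sets borel \<Longrightarrow> cinner (E B u) v = cinner u (E B v)"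
  and E_UNIV: "E UNIV u = u"
  and E_sums: "range C \<subseteq> sets borel \<Longrightarrow> disjoint_family C \<Longrightarrow> (\<lambda>n::nat. E (C n) u) sums E (\<Union>n. C n) u"
  using pvm[unfolded projection_valued_measure_def, THEN conjunct1]
    pvm[unfolded projection_valued_measure_def, THEN conjunct2, THEN conjunct1]
    pvm[unfolded projection_valued_measure_def, THEN conjunct2, THEN conjunct2]
  by (simp_all only: Ball_def)

lemma E_scaleR: "B \<in> sets borel \<Longrightarrow> E B (r *\<^sub>R u) = r *\<^sub>R E B u"
  by (simp add: scaleR_L2_def E_cscale)

lemma E_minus: "B \<in> sets borel \<Longrightarrow> E B (- u) = - E B u"
  using E_scaleR[of B "-1" u] by simp

lemma E_diff: "B \<in> sets borel \<Longrightarrow> E B (u - v) = E B u - E B v"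
  using E_add[of B u "- v"] by (simp add: E_minus)

lemma cinner_E_same: "B \<in> sets borel \<Longrightarrow> cinner (E B u) u = of_real ((norm (E B u))\<^sup>2)"
  using E_sym[of B "E B u" u] by (simp add: E_idem cinner_same)

lemma inner_E_same: "B \<in> sets borel \<Longrightarrow> inner (E B u) u = (norm (E B u))\<^sup>2"
  by (simp add: inner_L2_def cinner_E_same)

lemma norm_E_le: "B \<in> sets borel \<Longrightarrow> norm (E B u) \<le> norm u"
proof -
  assume "B \<in> sets borel"
  then have "norm (E B u) * norm (E B u) \<le> norm (E B u) * norm u"
    using norm_cauchy_schwarz[of "E B u" u] by (simp add: inner_E_same power2_eq_square)
  then show ?thesis by (cases "E B u = 0") auto
qed

text \<open>Countable additivity for the constant sequence of empty sets yields a convergent series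
  with constant terms, so the term is zero.\<close>

lemma E_empty [simp]: "E {} u = 0"
proof -
  have "(\<lambda>n::nat. E {} u) sums E {} u"
    using E_sums[of "\<lambda>_. {}" u] by (auto simp: disjoint_family_on_def)
  then have "(\<lambda>n::nat. E {} u) \<longlonglongrightarrow> 0" by (intro summable_LIMSEQ_zero) (auto simp: sums_iff)
  then show ?thesis by (simp add: LIMSEQ_const_iff)
qed

lemma E_Un:
  assumes "A \<in> sets borel" "B \<in> sets borel" "A \<inter> B = {}"
  shows "E (A \<union> B) u = E A u + E B u"
proof -
  have "(\<lambda>n. E (binaryset A B n) u) sums E (\<Union>n. binaryset A B n) u"
    using assms by (intro E_sums) (auto simp: range_binaryset_eq disjoint_family_on_def binaryset_def)
  moreover have "(\<lambda>n. E (binaryset A B n) u) sums (\<Sum>n<2. E (binaryset A B n) u)"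
    by (rule sums_finite) (auto simp: binaryset_def)
  ultimately show ?thesis
    by (auto simp: UN_binaryset_eq binaryset_def numeral_2_eq_2 dest: sums_unique2)
qed

text \<open>For \<open>x\<close> in the range of \<open>E B\<close>, the squared norm of
  \<open>E (A \<union> B) x\<close> is that of \<open>E A x\<close> plus that of \<open>x\<close>.
  Projections contract, so the first summand vanishes.\<close>

lemma E_disjoint:
  assumes "A \<in> sets borel" "B \<in> sets borel" "A \<inter> B = {}"
  shows "E A (E B u) = 0"
proof -
  define x where "x = E B u"
  have "(norm (E (A \<union> B) x))\<^sup>2 = inner (E A x + E B x) x"
    using assms E_Un[OF assms] inner_E_same[of "A \<union> B" x] by simp
  also have "\<dots> = (norm (E A x))\<^sup>2 + (norm x)\<^sup>2"
    using assms by (simp add: inner_add_left inner_E_same) (simp add: x_def E_idem)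
  finally have "(norm (E A x))\<^sup>2 + (norm x)\<^sup>2 \<le> (norm x)\<^sup>2"
    using norm_E_le[of "A \<union> B" x] assms by (metis norm_ge_zero power_mono sets.Un)
  then show ?thesis by (simp add: x_def)
qed

text \<open>Splitting \<open>A\<close> and \<open>B\<close> along \<open>A \<inter> B\<close> leaves
  only the common part, by orthogonality over disjoint sets.\<close>

lemma E_Int:
  assumes [measurable]: "A \<in> sets borel" "B \<in> sets borel"
  shows "E A (E B u) = E (A \<inter> B) u"
proof -
  have split: "E C y = E (C \<inter> D) y + E (C - D) y"
    if [measurable]: "C \<in> sets borel" "D \<in> sets borel" for C D y
    using E_Un[of "C \<inter> D" "C - D" y] by (simp add: Int_Diff_Un Int_Diff_disjoint)
  have "E A (E B u) = E A (E (A \<inter> B) u) + E A (E (B - A) u)"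
    using split[of B A u] by (simp add: E_add Int_commute)
  also have "E A (E (B - A) u) = 0" by (intro E_disjoint) auto
  also have "E A (E (A \<inter> B) u) = E (A \<inter> B) (E (A \<inter> B) u) + E (A - B) (E (A \<inter> B) u)"
    using split[of A B "E (A \<inter> B) u"] by simp
  also have "E (A - B) (E (A \<inter> B) u) = 0" by (intro E_disjoint) auto
  finally show ?thesis by (simp add: E_idem)
qed

lemma E_Compl: "B \<in> sets borel \<Longrightarrow> E B u + E (- B) u = u"
  using E_Un[of B "- B" u] by (simp add: E_UNIV)

lemma tendsto_E:
  assumes "B \<in> sets borel" "(f \<longlongrightarrow> u) G"
  shows "((\<lambda>n. E B (f n)) \<longlongrightarrow> E B u) G"
proof (rule tendstoI)
  fix e :: real assume "e > 0"
  then have "\<forall>\<^sub>F n in G. dist (f n) u < e" using assms(2) by (rule tendstoD[rotated])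
  then show "\<forall>\<^sub>F n in G. dist (E B (f n)) (E B u) < e"
    by eventually_elim
       (metis E_diff[OF assms(1)] dist_norm le_less_trans norm_E_le[OF assms(1)])
qed

lemma norm_E_sums:
  assumes "range C \<subseteq> sets borel" "disjoint_family C"
  shows "(\<lambda>n::nat. (norm (E (C n) u))\<^sup>2) sums (norm (E (\<Union>n. C n) u))\<^sup>2"
proof -
  have "(\<lambda>n. inner (E (C n) u) u) sums inner (E (\<Union>n. C n) u) u"
    by (rule bounded_linear.sums[OF bounded_linear_inner_left E_sums[OF assms]])
  moreover have "C n \<in> sets borel" for n using assms by auto
  ultimately show ?thesis
    by (simp add: inner_E_same sets.countable_UN)
qed

section \<open>Scalar spectral measures\<close>

abbreviation \<mu> :: "L2 \<Rightarrow> real measure" where "\<mu> u \<equiv> scalar_spectral_measure E u"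

lemma space_\<mu> [simp]: "space (\<mu> u) = UNIV"
  and sets_\<mu> [simp, measurable_cong]: "sets (\<mu> u) = sets borel"
  using sets.sigma_sets_eq[of borel] by (simp_all add: scalar_spectral_measure_def)

lemma emeasure_\<mu>:
  assumes "B \<in> sets borel"
  shows "emeasure (\<mu> u) B = ennreal ((norm (E B u))\<^sup>2)"
  unfolding scalar_spectral_measure_def
proof (rule emeasure_measure_of_sigma)
  show "sigma_algebra UNIV (sets (borel :: real measure))"
    using sets.sigma_algebra_axioms[of "borel :: real measure"] by simp
  show "positive (sets borel) (\<lambda>B :: real set. ennreal ((norm (E B u))\<^sup>2))"
    by (simp add: positive_def)
  show "countably_additive (sets borel) (\<lambda>B :: real set. ennreal ((norm (E B u))\<^sup>2))"
  proof (rule countably_additiveI)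
    fix A :: "nat \<Rightarrow> real set"
    assume "range A \<subseteq> sets borel" "disjoint_family A"
    then show "(\<Sum>i. ennreal ((norm (E (A i) u))\<^sup>2)) = ennreal ((norm (E (\<Union> (range A)) u))\<^sup>2)"
      by (intro suminf_ennreal_eq norm_E_sums) auto
  qed
qed (use assms in simp)

sublocale \<mu>: finite_measure "\<mu> u" for u
  by standard (simp add: emeasure_\<mu>)

lemma measure_\<mu>: "B \<in> sets borel \<Longrightarrow> measure (\<mu> u) B = (norm (E B u))\<^sup>2"
  by (simp add: measure_def emeasure_\<mu>)

text \<open>Multiplicativity of \<open>E\<close> turns cutting the vector into cutting its measure;
  integrals over \<open>B\<close> thereby become quadratic forms at \<open>E B u\<close>.\<close>

lemma \<mu>_E:
  assumes [measurable]: "B \<in> sets borel"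
  shows "\<mu> (E B u) = density (\<mu> u) (indicator B)"
proof (rule measure_eqI)
  fix A assume "A \<in> sets (\<mu> (E B u))"
  then have [measurable]: "A \<in> sets borel" by simp
  have "emeasure (density (\<mu> u) (indicator B)) A = (\<integral>\<^sup>+t. indicator B t * indicator A t \<partial>\<mu> u)"
    by (intro emeasure_density) auto
  also have "\<dots> = (\<integral>\<^sup>+t. indicator (B \<inter> A) t \<partial>\<mu> u)"
    by (intro nn_integral_cong) (auto split: split_indicator)
  finally have "emeasure (density (\<mu> u) (indicator B)) A = (\<integral>\<^sup>+t. indicator (B \<inter> A) t \<partial>\<mu> u)" .
  then show "emeasure (\<mu> (E B u)) A = emeasure (density (\<mu> u) (indicator B)) A"
    by (simp add: emeasure_\<mu> E_Int Int_commute)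
qed simp

lemma integral_\<mu>_E:
  fixes F :: "real \<Rightarrow> real"
  assumes [measurable]: "B \<in> sets borel" "F \<in> borel_measurable borel"
  shows "(LINT t|\<mu> (E B u). F t) = (LINT t|\<mu> u. indicator B t * F t)"
proof -
  have "\<mu> (E B u) = density (\<mu> u) (\<lambda>t. ennreal (indicator B t))"
    by (simp add: \<mu>_E ennreal_indicator)
  then show ?thesis by (simp add: integral_density)
qed

lemma AE_\<mu>:
  assumes [measurable]: "B \<in> sets borel" and "E B u = u"
  shows "AE t in \<mu> u. t \<in> B"
proof (rule AE_I)
  show "emeasure (\<mu> u) (- B) = 0"
    using E_Compl[OF assms(1), of u] assms(2) by (simp add: emeasure_\<mu>)
qed auto

end

section \<open>Operator calculus recovered from the quadratic form of a spectral integral\<close>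

locale spectral_integral = pvm +
  fixes F :: "real \<Rightarrow> real" and T :: oper
  assumes F_measurable [measurable]: "F \<in> borel_measurable borel"
    and spectral: "is_spectral_integral E F T"
begin

lemma linear: "linear_oper T"
  using spectral by (simp add: is_spectral_integral_def)

lemma T_unique: "(u, f) \<in> T \<Longrightarrow> (u, g) \<in> T \<Longrightarrow> f = g"
  using linear by (auto simp: linear_oper_def single_valued_def)

lemma T_add: "(u, f) \<in> T \<Longrightarrow> (v, g) \<in> T \<Longrightarrow> (u + v, f + g) \<in> T"
  using linear by (auto simp: linear_oper_def)

lemma T_cscale: "(u, f) \<in> T \<Longrightarrow> (cscale a u, cscale a f) \<in> T"
  using linear by (auto simp: linear_oper_def)

lemma Domain_iff: "u \<in> Domain T \<longleftrightarrow> (\<integral>\<^sup>+t. ennreal ((F t)\<^sup>2) \<partial>\<mu> u) < \<infinity>"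
  using spectral by (simp add: is_spectral_integral_def)

lemma cinner_eq_integral: "(u, f) \<in> T \<Longrightarrow> cinner f u = of_real (LINT t|\<mu> u. F t)"
  using spectral by (auto simp: is_spectral_integral_def)

lemma inner_eq_integral: "(u, f) \<in> T \<Longrightarrow> inner f u = (LINT t|\<mu> u. F t)"
  by (simp add: inner_L2_def cinner_eq_integral)

lemma cinner_real: "(u, f) \<in> T \<Longrightarrow> cinner f u = of_real (inner f u)"
  by (simp add: cinner_eq_integral inner_eq_integral)

text \<open>The measure is finite and \<open>\<bar>F t\<bar>\<close> is at most
  \<open>1 + (F t)\<^sup>2\<close>.\<close>

lemma integrable_F:
  assumes "u \<in> Domain T"
  shows "integrable (\<mu> u) F"
proof -
  have "integrable (\<mu> u) (\<lambda>t. (F t)\<^sup>2)"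
    using assms by (intro integrableI_bounded) (auto simp: Domain_iff)
  then have i: "integrable (\<mu> u) (\<lambda>t. 1 + (F t)\<^sup>2)" by simp
  have "\<bar>F t\<bar> \<le> 1 + (F t)\<^sup>2" for t
    using sum_squares_bound[of 1 "\<bar>F t\<bar>"] by simp
  then show ?thesis
    by (intro Bochner_Integration.integrable_bound[OF i]) auto
qed

lemma Domain_E:
  assumes "B \<in> sets borel" "u \<in> Domain T"
  shows "E B u \<in> Domain T"
proof -
  have "(\<integral>\<^sup>+t. ennreal ((F t)\<^sup>2) \<partial>\<mu> (E B u)) \<le> (\<integral>\<^sup>+t. ennreal ((F t)\<^sup>2) \<partial>\<mu> u)"
    using assms by (auto simp: \<mu>_E nn_integral_density intro!: nn_integral_mono split: split_indicator)
  also have "\<dots> < \<infinity>" using assms by (simp add: Domain_iff)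
  finally show ?thesis unfolding Domain_iff .
qed

text \<open>Spectral cutoffs of arbitrary vectors to sets where \<open>F\<close> is bounded lie in
  the domain; they serve as test vectors for identities about \<open>T\<close>.\<close>

lemma Domain_E_bounded:
  assumes [measurable]: "B \<in> sets borel" and "\<And>t. t \<in> B \<Longrightarrow> \<bar>F t\<bar> \<le> M"
  shows "E B u \<in> Domain T"
proof -
  have "ennreal ((F t)\<^sup>2) * indicator B t \<le> ennreal (M\<^sup>2)" for t
  proof (cases "t \<in> B")
    case True
    then have "\<bar>F t\<bar>\<^sup>2 \<le> M\<^sup>2" using assms(2) by (intro power_mono) auto
    then show ?thesis using True by simp
  qed simp
  then have "(\<integral>\<^sup>+t. ennreal ((F t)\<^sup>2) * indicator B t \<partial>\<mu> u) \<le> (\<integral>\<^sup>+t. ennreal (M\<^sup>2) \<partial>\<mu> u)"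
    by (rule nn_integral_mono)
  then have "(\<integral>\<^sup>+t. ennreal ((F t)\<^sup>2) \<partial>\<mu> (E B u)) \<le> (\<integral>\<^sup>+t. ennreal (M\<^sup>2) \<partial>\<mu> u)"
    by (simp add: \<mu>_E nn_integral_density mult.commute)
  also have "\<dots> < \<infinity>" by (simp add: emeasure_\<mu> ennreal_mult_less_top)
  finally show ?thesis unfolding Domain_iff .
qed

text \<open>\<open>(T x, x)\<close> is additive for \<open>x = u + v\<close> with orthogonal spectral supports; replacing \<open>v\<close> by \<open>\<i> v\<close> then
  kills \<open>(T u, v)\<close>.\<close>

lemma cinner_disjoint:
  assumes uf: "(u, f) \<in> T" and vg: "(v, g) \<in> T"
    and [measurable]: "A \<in> sets borel" "B \<in> sets borel" and "A \<inter> B = {}"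
    and "E A u = u" "E B v = v"
  shows "cinner f v = 0"
proof -
  have additive: "cinner (f + g) (u + v) = cinner f u + cinner g v"
    if uf: "(u, f) \<in> T" and vg: "(v, g) \<in> T" and Eu: "E A u = u" and Ev: "E B v = v" for u v f g
  proof -
    have D: "(u + v, f + g) \<in> T" using uf vg by (rule T_add)
    have "E B u = 0" using E_disjoint[of B A u] assms(5) Eu by auto
    then have EB: "E B (u + v) = v" using Ev by (simp add: E_add)
    have "E A v = 0" using E_disjoint[of A B v] assms(5) Ev by auto
    then have EA: "E A (u + v) = u" using Eu by (simp add: E_add)
    have "E (A \<union> B) (u + v) = u + v" using EA EB assms(5) by (simp add: E_Un)
    then have AE: "AE t in \<mu> (u + v). t \<in> A \<union> B" by (intro AE_\<mu>) auto
    have i: "integrable (\<mu> (u + v)) F" using D by (intro integrable_F) auto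
    have "(LINT t|\<mu> (u + v). F t) = (LINT t|\<mu> (u + v). indicator A t * F t + indicator B t * F t)"
      using AE assms(5) by (intro integral_cong_AE) (auto simp: indicator_def elim!: eventually_mono)
    also have "\<dots> = (LINT t|\<mu> (u + v). indicator A t * F t) + (LINT t|\<mu> (u + v). indicator B t * F t)"
      by (intro Bochner_Integration.integral_add integrable_mult_indicator[of _ _ F, simplified] i) auto
    also have "(LINT t|\<mu> (u + v). indicator A t * F t) = (LINT t|\<mu> (E A (u + v)). F t)"
      by (simp add: integral_\<mu>_E)
    also have "(LINT t|\<mu> (u + v). indicator B t * F t) = (LINT t|\<mu> (E B (u + v)). F t)"
      by (simp add: integral_\<mu>_E)
    finally show ?thesis using uf vg D by (simp add: EA EB cinner_eq_integral)
  qed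
  have 1: "cinner f v + cinner g u = 0"
    using additive[OF uf vg] assms by (auto simp: cinner_simps add.commute)
  have "cinner f (cscale \<i> v) + cinner (cscale \<i> g) u = 0"
    using additive[OF uf T_cscale[OF vg, of \<i>]] assms
    by (auto simp: cinner_add_left cinner_add_right E_cscale add.commute)
  then have "\<i> * (cinner g u - cinner f v) = 0"
    by (simp add: cinner_cscale_left cinner_cscale_right right_diff_distrib)
  then have "cinner g u = cinner f v" by simp
  then show ?thesis using 1 by simp
qed

text \<open>Slicing \<open>X\<close> by the integer part of \<open>\<bar>F t\<bar>\<close> gives
  countably many disjoint pieces on which \<open>F\<close> is bounded, so vanishing can be tested
  where \<open>Domain_E_bounded\<close> applies.\<close>

lemma E_eq_0I:
  assumes X: "X \<in> sets borel"
    and 0: "\<And>C. C \<in> sets borel \<Longrightarrow> C \<subseteq> X \<Longrightarrow> bounded (F ` C) \<Longrightarrow> E C y = 0"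
  shows "E X y = 0"
proof -
  define C where "C n = X \<inter> {t. nat \<lfloor>\<bar>F t\<bar>\<rfloor> = n}" for n
  have "{t \<in> space borel. nat \<lfloor>\<bar>F t\<bar>\<rfloor> = n} \<in> sets borel" for n by measurable
  then have C: "C n \<in> sets borel" for n using X by (simp add: C_def sets.Int)
  have "bounded (F ` C n)" for n
    unfolding bounded_iff by (rule exI[of _ "real n + 1"]) (auto simp: C_def; linarith)
  then have "E (C n) y = 0" for n by (intro 0 C) (simp add: C_def)
  moreover have "(\<lambda>n. E (C n) y) sums E (\<Union>n. C n) y"
    using C by (intro E_sums) (auto simp: disjoint_family_on_def C_def[abs_def])
  moreover have "(\<Union>n. C n) = X" by (auto simp: C_def)
  ultimately show ?thesis by (simp add: sums_iff)
qed

text \<open>Split \<open>u\<close> into \<open>E B u\<close> and \<open>E (- B) u\<close>. By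
  \<open>cinner_disjoint\<close> the image of each part is orthogonal to every bounded cutoff living
  on the other set, hence has no component there; applying \<open>E B\<close> to the sum of the
  images isolates the first.\<close>

lemma T_commute:
  assumes uf: "(u, f) \<in> T" and [measurable]: "B \<in> sets borel"
  shows "(E B u, E B f) \<in> T"
proof -
  have "E A f1 = 0" if [measurable]: "A \<in> sets borel" "C \<in> sets borel" and AC: "A \<inter> C = {}"
    and f1: "(E C u, f1) \<in> T" for A C f1
  proof (rule E_eq_0I)
    fix X assume [measurable]: "X \<in> sets borel" and X: "X \<subseteq> A" "bounded (F ` X)"
    then obtain M where "\<And>t. t \<in> X \<Longrightarrow> \<bar>F t\<bar> \<le> M" by (auto simp: bounded_iff)
    then obtain g where "(E X f1, g) \<in> T" using Domain_E_bounded[of X M f1] by auto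
    then have "cinner f1 (E X f1) = 0"
      using X AC by (intro cinner_disjoint[OF f1, where A = C and B = X]) (auto simp: E_idem)
    then show "E X f1 = 0" by (simp add: cinner_E_same flip: E_sym)
  qed fact
  note * = this
  have "E B u \<in> Domain T" "E (- B) u \<in> Domain T" using uf by (auto intro!: Domain_E)
  then obtain f1 f2 where f1: "(E B u, f1) \<in> T" and f2: "(E (- B) u, f2) \<in> T" by auto
  have "f = f1 + f2" using T_add[OF f1 f2] uf by (auto simp: E_Compl intro: T_unique)
  moreover have "E (- B) f1 = 0" by (rule *[OF _ _ _ f1]) auto
  moreover have "E B f2 = 0" by (rule *[OF _ _ _ f2]) auto
  ultimately have "E B f = f1" using E_Compl[of B f1] by (simp add: E_add)
  then show ?thesis using f1 by simp
qed

lemma abs_inner_le: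
  assumes uf: "(u, f) \<in> T" and [measurable]: "B \<in> sets borel" and F: "\<And>t. t \<in> B \<Longrightarrow> \<bar>F t\<bar> \<le> M"
    and u: "E B u = u"
  shows "\<bar>inner f u\<bar> \<le> M * (norm u)\<^sup>2"
proof -
  have "\<bar>LINT t|\<mu> u. F t\<bar> \<le> (LINT t|\<mu> u. \<bar>F t\<bar>)" by (rule integral_abs_bound)
  also have "\<dots> \<le> (LINT t|\<mu> u. M)"
    using integrable_F[of u] uf AE_\<mu>[OF _ u] F
    by (intro integral_mono_AE) (auto elim!: eventually_mono)
  also have "\<dots> = M * (norm u)\<^sup>2" using measure_\<mu>[of UNIV u] by (simp add: E_UNIV)
  finally show ?thesis by (simp add: inner_eq_integral[OF uf])
qed

text \<open>The quadratic form is real at \<open>u\<close>, at \<open>v\<close> and at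
  \<open>u + cscale \<i> v\<close>; the imaginary part of the last value is the difference of the
  two sides.\<close>

lemma inner_symmetric:
  assumes uf: "(u, f) \<in> T" and vg: "(v, g) \<in> T"
  shows "inner f v = inner u g"
proof -
  have "cinner (f + cscale \<i> g) (u + cscale \<i> v) = of_real (inner (f + cscale \<i> g) (u + cscale \<i> v))"
    by (intro cinner_real T_add T_cscale uf vg)
  then have "Im (cinner f (cscale \<i> v) + cinner (cscale \<i> g) u) = 0"
    using cinner_real[OF uf] cinner_real[OF vg]
    by (simp add: cinner_add_left cinner_add_right) (simp add: cinner_simps complex_eq_iff)
  then show ?thesis by (simp add: cinner_simps inner_L2_def inner_commute cinner_commute[of u g])
qed

text \<open>On the range of \<open>E B\<close> the operator is symmetric with numerical range in
  \<open>[-M, M]\<close>, so its norm there is at most \<open>M\<close>. The cutoff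
  \<open>E B f\<close> lies in the domain because \<open>F\<close> is bounded on \<open>B\<close>,
  and \<open>h\<close> is its image.\<close>

lemma norm_E_T_le:
  assumes uf: "(u, f) \<in> T" and B [measurable]: "B \<in> sets borel" and F: "\<And>t. t \<in> B \<Longrightarrow> \<bar>F t\<bar> \<le> M"
    and M: "M > 0"
  shows "norm (E B f) \<le> M * norm (E B u)"
proof -
  have v: "(E B u, E B f) \<in> T" using uf by (rule T_commute) fact
  obtain h where h: "(E B f, h) \<in> T" using Domain_E_bounded[OF B F, of f] by auto
  then have "(E B f, E B h) \<in> T" using T_commute[OF h B] by (simp add: E_idem)
  then have "E B h = h" using h by (rule T_unique)
  show ?thesis
  proof (rule numerical_range_norm_le[OF M])
    show "inner h (E B u) = inner (E B f) (E B f)"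
      using inner_symmetric[OF h v] by simp
    fix r
    have "(E B u + r *\<^sub>R E B f, E B f + r *\<^sub>R h) \<in> T"
      using T_add[OF v T_cscale[OF h, of "of_real r"]] by (simp add: cscale_of_real)
    then show "\<bar>inner (E B f + r *\<^sub>R h) (E B u + r *\<^sub>R E B f)\<bar> \<le> M * (norm (E B u + r *\<^sub>R E B f))\<^sup>2"
      by (rule abs_inner_le[OF _ B F]) (simp_all add: E_add E_scaleR E_idem)
  qed
qed

lemma inner_ge:
  assumes uf: "(u, f) \<in> T" and [measurable]: "B \<in> sets borel" and F: "\<And>t. t \<in> B \<Longrightarrow> m \<le> F t"
  shows "m * (norm (E B u))\<^sup>2 \<le> inner (E B f) (E B u)"
proof -
  have v: "(E B u, E B f) \<in> T" using uf by (rule T_commute) fact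
  have "m * (norm (E B u))\<^sup>2 = (LINT t|\<mu> (E B u). m)"
    using measure_\<mu>[of UNIV "E B u"] by (simp add: E_UNIV)
  also have "\<dots> \<le> (LINT t|\<mu> (E B u). F t)"
    using integrable_F[of "E B u"] v AE_\<mu>[of B "E B u"] F
    by (intro integral_mono_AE) (auto simp: E_idem elim!: eventually_mono)
  finally show ?thesis by (simp add: inner_eq_integral[OF v])
qed

lemma inner_le:
  assumes uf: "(u, f) \<in> T" and [measurable]: "B \<in> sets borel" and F: "\<And>t. t \<in> B \<Longrightarrow> F t \<le> m"
  shows "inner (E B f) (E B u) \<le> m * (norm (E B u))\<^sup>2"
proof -
  have v: "(E B u, E B f) \<in> T" using uf by (rule T_commute) fact
  have "(LINT t|\<mu> (E B u). F t) \<le> (LINT t|\<mu> (E B u). m)"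
    using integrable_F[of "E B u"] v AE_\<mu>[of B "E B u"] F
    by (intro integral_mono_AE) (auto simp: E_idem elim!: eventually_mono)
  also have "\<dots> = m * (norm (E B u))\<^sup>2"
    using measure_\<mu>[of UNIV "E B u"] by (simp add: E_UNIV)
  finally show ?thesis by (simp add: inner_eq_integral[OF v])
qed

text \<open>The lower bound for the form passes to the norm by Cauchy-Schwarz.\<close>

lemma norm_E_T_ge:
  assumes uf: "(u, f) \<in> T" and [measurable]: "B \<in> sets borel" and F: "\<And>t. t \<in> B \<Longrightarrow> m \<le> F t"
  shows "m * norm (E B u) \<le> norm (E B f)"
proof -
  have "m * (norm (E B u))\<^sup>2 \<le> norm (E B f) * norm (E B u)"
    using inner_ge[OF uf _ F] norm_cauchy_schwarz[of "E B f" "E B u"] by (meson assms(2) order_trans)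
  then show ?thesis by (cases "E B u = 0") (auto simp: power2_eq_square)
qed

end

section \<open>Fractional powers and resolvents\<close>

text \<open>For negative \<open>t\<close>, \<open>powr\<close> goes through \<open>ln\<close>, which
  takes the same value at \<open>t\<close> and \<open>- t\<close>.\<close>

lemma powr_abs_real: "t powr a = \<bar>t\<bar> powr a" for t a :: real
  by (cases "t < 0") (simp_all add: powr_def ln_minus)

text \<open>Shells in the modulus of \<open>t\<close>, so that both half-lines are treated alike.
  The shell with index 0 is the whole interval of modulus below 4, which makes the shells a
  partition of the line. The ratio 4 makes the square root of the modulus comparable to
  \<open>2 ^ j\<close> on shell \<open>j\<close>.\<close>

definition dyadic :: "nat \<Rightarrow> real set" where
  "dyadic j = {t. (j = 0 \<or> 4 ^ j \<le> \<bar>t\<bar>) \<and> \<bar>t\<bar> < 4 * 4 ^ j}"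

lemma dyadic_measurable [measurable, simp]: "dyadic j \<in> sets borel"
  unfolding dyadic_def by measurable

lemma dyadic_ge: "t \<in> dyadic j \<Longrightarrow> j > 0 \<Longrightarrow> 4 ^ j \<le> \<bar>t\<bar>"
  and dyadic_le: "t \<in> dyadic j \<Longrightarrow> \<bar>t\<bar> \<le> 4 * 4 ^ j"
  by (auto simp: dyadic_def)

lemma disjoint_family_dyadic: "disjoint_family dyadic"
proof -
  have "dyadic i \<inter> dyadic j = {}" if "i < j" for i j
  proof -
    have "(4::real) * 4 ^ i \<le> 4 ^ j"
      using that power_increasing[of "Suc i" j "4::real"] by simp
    then show ?thesis using that by (auto simp: dyadic_def)
  qed
  then have "dyadic i \<inter> dyadic j = {}" if "i \<noteq> j" for i j
    using that by (metis Int_commute linorder_neqE_nat)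
  then show ?thesis by (auto simp: disjoint_family_on_def)
qed

lemma UN_dyadic: "(\<Union>j. dyadic j) = UNIV"
proof -
  have "\<exists>j. t \<in> dyadic j" for t
  proof -
    define j where "j = (LEAST j. \<bar>t\<bar> < 4 * 4 ^ j)"
    obtain n where "\<bar>t\<bar> < 4 ^ n" using real_arch_pow[of 4 "\<bar>t\<bar>"] by auto
    then have ex: "\<bar>t\<bar> < 4 * 4 ^ n" by simp
    have j: "\<bar>t\<bar> < 4 * 4 ^ j" unfolding j_def by (rule LeastI, rule ex)
    moreover have "4 ^ j \<le> \<bar>t\<bar>" if "j \<noteq> 0"
    proof -
      from that obtain i where "j = Suc i" by (cases j) auto
      then show ?thesis using not_less_Least[of i "\<lambda>j. \<bar>t\<bar> < 4 * 4 ^ j"] by (simp add: j_def)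
    qed
    ultimately show ?thesis by (auto simp: dyadic_def)
  qed
  then show ?thesis by auto
qed

text \<open>Discrete counterpart of: the integral of \<open>s powr (-1/2) * min 1 (t / s)\<close>
  over positive \<open>s\<close> is \<open>4 * sqrt t\<close>. The terms are bounded by a growing
  geometric series up to \<open>k = j\<close> and by a decaying one afterwards.\<close>

lemma dyadic_kernel_sum:
  "(\<Sum>k<N. 2 ^ k * min 1 (2 * 4 ^ j / 4 ^ k)) \<le> (4 * 2 ^ j :: real)"
proof -
  let ?s = "\<lambda>N. \<Sum>k<N. 2 ^ k * min 1 (2 * 4 ^ j / 4 ^ k :: real)"
  have "?s N \<le> 2 ^ N - 1" for N
  proof (induction N)
    case (Suc N)
    have "2 ^ N * min 1 (2 * 4 ^ j / 4 ^ N :: real) \<le> 2 ^ N * 1" by (intro mult_left_mono) auto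
    then show ?case using Suc unfolding sum.lessThan_Suc power_Suc by linarith
  qed simp
  note start = this
  \<comment> \<open>The subtracted term is the whole remaining geometric tail, the sum of
    \<open>2 * 4 ^ j / 2 ^ k\<close> over \<open>k\<close> from \<open>j + 1 + n\<close> on; with it
    the bound is inductive.\<close>
  have tail: "?s (j + 1 + n) \<le> 4 * 2 ^ j - 4 * 4 ^ j / 2 ^ (j + 1 + n)" for n
  proof (induction n)
    case 0
    have "(4::real) ^ j = 2 ^ j * 2 ^ j" by (simp flip: power_mult_distrib)
    then show ?case using start[of "j + 1"] by simp
  next
    case (Suc n)
    let ?k = "j + 1 + n"
    have "(4::real) ^ ?k = 2 ^ ?k * 2 ^ ?k" by (simp flip: power_mult_distrib)
    then have "2 ^ ?k * (2 * 4 ^ j / 4 ^ ?k) = (2 * 4 ^ j / 2 ^ ?k :: real)" by simp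
    moreover have "2 ^ ?k * min 1 (2 * 4 ^ j / 4 ^ ?k) \<le> 2 ^ ?k * (2 * 4 ^ j / 4 ^ ?k :: real)"
      by (intro mult_left_mono) auto
    moreover have "?s (j + 1 + Suc n) = ?s ?k + 2 ^ ?k * min 1 (2 * 4 ^ j / 4 ^ ?k)" by simp
    moreover have "(4 * 4 ^ j / 2 ^ (j + 1 + Suc n) :: real) = 2 * 4 ^ j / 2 ^ ?k" by simp
    moreover have "(4 * 4 ^ j / 2 ^ ?k :: real) = 2 * (2 * 4 ^ j / 2 ^ ?k)" by simp
    ultimately show ?case using Suc by linarith
  qed
  have "?s N \<le> ?s (j + 1 + N)" by (intro sum_mono2) auto
  also have "\<dots> \<le> 4 * 2 ^ j - 4 * 4 ^ j / 2 ^ (j + 1 + N)" by (rule tail)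
  also have "\<dots> \<le> 4 * 2 ^ j" by simp
  finally show ?thesis .
qed

section \<open>Shellwise estimates for square roots, fourth roots and resolvents\<close>

context pvm
begin

lemma inner_E_sym: "B \<in> sets borel \<Longrightarrow> inner (E B u) v = inner u (E B v)"
  by (simp add: inner_L2_def E_sym)

lemma inner_E_idem: "B \<in> sets borel \<Longrightarrow> inner (E B u) (E B v) = inner (E B u) v"
  by (metis inner_E_sym E_idem)

lemma cinner_E_idem: "B \<in> sets borel \<Longrightarrow> cinner (E B u) (E B v) = cinner (E B u) v"
  by (metis E_sym E_idem)

lemma dyadic_sums: "(\<lambda>j. E (dyadic j) u) sums u"
  using E_sums[of dyadic u] disjoint_family_dyadic by (simp add: UN_dyadic E_UNIV image_subset_iff)

lemma norm_dyadic_sums: "(\<lambda>j. (norm (E (dyadic j) u))\<^sup>2) sums (norm u)\<^sup>2"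
  using norm_E_sums[of dyadic u] disjoint_family_dyadic by (simp add: UN_dyadic E_UNIV image_subset_iff)

lemma nn_integral_abs_finite:
  assumes "(\<integral>\<^sup>+t. ennreal (t\<^sup>2) \<partial>\<mu> v) < \<infinity>"
  shows "(\<integral>\<^sup>+t. ennreal \<bar>t\<bar> \<partial>\<mu> v) < \<infinity>"
proof -
  have "ennreal \<bar>t\<bar> \<le> ennreal (1 + t\<^sup>2)" for t :: real
    using sum_squares_bound[of 1 "\<bar>t\<bar>"] by (intro ennreal_leI) simp
  then have "ennreal \<bar>t\<bar> \<le> ennreal 1 + ennreal (t\<^sup>2)" for t :: real
    by (subst ennreal_plus[symmetric]) auto
  then have "(\<integral>\<^sup>+t. ennreal \<bar>t\<bar> \<partial>\<mu> v) \<le> (\<integral>\<^sup>+t. ennreal 1 + ennreal (t\<^sup>2) \<partial>\<mu> v)"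
    by (rule nn_integral_mono)
  also have "\<dots> = (\<integral>\<^sup>+t. ennreal 1 \<partial>\<mu> v) + (\<integral>\<^sup>+t. ennreal (t\<^sup>2) \<partial>\<mu> v)"
    by (rule nn_integral_add) auto
  also have "(\<integral>\<^sup>+t. ennreal 1 \<partial>\<mu> v) = ennreal ((norm v)\<^sup>2)"
    using emeasure_\<mu>[of UNIV v] by (simp add: E_UNIV)
  also have "\<dots> + (\<integral>\<^sup>+t. ennreal (t\<^sup>2) \<partial>\<mu> v) < \<infinity>" using assms by simp
  finally show ?thesis .
qed

text \<open>A substitute, up to constants, for the identity between the squared norm of the square
  root and the form. On shell \<open>j\<close> the squared norm of \<open>E (dyadic j) f\<close> is
  at most \<open>4 * 4 ^ j\<close> times that of \<open>E (dyadic j) v\<close>; for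
  \<open>j > 0\<close> this is absorbed by the form, for \<open>j = 0\<close> by the norm of
  \<open>v\<close>.\<close>

lemma sqrt_oper_bound:
  assumes H: "is_spectral_integral E (\<lambda>t. t) H" and S: "is_spectral_integral E (\<lambda>t. t powr (1/2)) S"
    and pos: "\<And>u f. (u, f) \<in> H \<Longrightarrow> 0 \<le> inner f u" and vh: "(v, h) \<in> H"
  shows "\<exists>f. (v, f) \<in> S \<and> (norm f)\<^sup>2 \<le> 4 * (norm v)\<^sup>2 + 4 * inner h v"
proof -
  interpret H: spectral_integral E "\<lambda>t. t" H by unfold_locales (use H in auto)
  interpret S: spectral_integral E "\<lambda>t. t powr (1/2)" S by unfold_locales (use S in auto)
  have sq: "(t powr (1/2))\<^sup>2 = \<bar>t\<bar>" for t :: real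
    by (subst powr_abs_real) (simp add: powr_half_sqrt)
  have "v \<in> Domain H" using vh by blast
  then have "(\<integral>\<^sup>+t. ennreal ((t powr (1/2))\<^sup>2) \<partial>\<mu> v) < \<infinity>"
    unfolding sq H.Domain_iff by (rule nn_integral_abs_finite)
  then have "v \<in> Domain S" by (simp only: S.Domain_iff)
  then obtain f where f: "(v, f) \<in> S" by blast
  have piece: "(norm (E (dyadic j) f))\<^sup>2 \<le> 4 * (norm (E (dyadic j) v))\<^sup>2 + 4 * inner (E (dyadic j) h) v" for j
  proof -
    let ?B = "dyadic j"
    have "norm (E ?B f) \<le> (2 * 2 ^ j) * norm (E ?B v)"
    proof (rule S.norm_E_T_le[OF f])
      fix t assume "t \<in> ?B"
      then have "\<bar>t\<bar> \<le> (2 * 2 ^ j)\<^sup>2"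
        by (auto dest: dyadic_le simp: power2_eq_square simp flip: power_mult_distrib)
      then have "\<bar>t powr (1/2)\<bar>\<^sup>2 \<le> (2 * 2 ^ j)\<^sup>2" by (simp add: sq)
      then show "\<bar>t powr (1/2)\<bar> \<le> 2 * 2 ^ j" by (rule power2_le_imp_le) simp
    qed auto
    then have "(norm (E ?B f))\<^sup>2 \<le> ((2 * 2 ^ j) * norm (E ?B v))\<^sup>2" by (intro power_mono) auto
    also have "\<dots> = 4 * 4 ^ j * (norm (E ?B v))\<^sup>2"
      by (simp add: power_mult_distrib power_mult[symmetric] mult.commute[of _ 2])
         (simp add: power_mult)
    finally have 1: "(norm (E ?B f))\<^sup>2 \<le> 4 * (4 ^ j * (norm (E ?B v))\<^sup>2)" by simp
    have p: "0 \<le> inner (E ?B h) v"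
      using pos[OF H.T_commute[OF vh, of ?B]] by (simp add: inner_E_idem)
    show ?thesis
    proof (cases "j = 0")
      case True
      then show ?thesis using 1 p by simp
    next
      case False
      \<comment> \<open>Positivity kills the negative half of the shell: there the form is
        nonnegative, yet at most \<open>- (4 ^ j)\<close> times the squared norm.\<close>
      define N where "N = ?B \<inter> {..<0}"
      define P where "P = ?B \<inter> {0..}"
      have [measurable]: "N \<in> sets borel" "P \<in> sets borel" by (auto simp: N_def P_def)
      have B: "?B = P \<union> N" "P \<inter> N = {}" by (auto simp: N_def P_def)
      have "0 \<le> inner (E N h) (E N v)" by (rule pos[OF H.T_commute[OF vh]]) simp
      also have "\<dots> \<le> (- (4 ^ j)) * (norm (E N v))\<^sup>2"
        by (rule H.inner_le[OF vh]) (use False in \<open>auto simp: N_def dest!: dyadic_ge\<close>)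
      finally have "4 ^ j * (norm (E N v))\<^sup>2 \<le> 0" by simp
      moreover have "(4::real) ^ j > 0" by simp
      ultimately have "E N v = 0" by (auto simp: mult_le_0_iff)
      then have BP: "E ?B v = E P v" using B by (simp add: E_Un)
      have "4 ^ j * (norm (E P v))\<^sup>2 \<le> inner (E P h) (E P v)"
        by (rule H.inner_ge[OF vh]) (use False in \<open>auto simp: P_def dest!: dyadic_ge\<close>)
      also have "\<dots> = inner (E ?B h) v" by (simp add: inner_E_sym E_idem BP)
      finally show ?thesis
        using 1 zero_le_power2[of "norm (E P v)"] unfolding BP by linarith
    qed
  qed
  have "(norm f)\<^sup>2 \<le> 4 * (norm v)\<^sup>2 + 4 * inner h v"
    by (rule sums_le[OF piece norm_dyadic_sums])
       (intro sums_add sums_mult norm_dyadic_sums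
         bounded_linear.sums[OF bounded_linear_inner_left dyadic_sums])
  then show ?thesis using f by blast
qed

text \<open>On shell \<open>Suc j\<close> the multiplier is at least \<open>m\<close>, the fourth
  root of \<open>4 ^ Suc j\<close>, whose square is the weight \<open>2 ^ Suc j\<close>. Shell 0 is
  left out, having no positive lower bound.\<close>

lemma fourth_root_oper_ge:
  assumes T: "is_spectral_integral E (\<lambda>t. t powr (1/4)) T" and vg: "(v, g) \<in> T"
  shows "(\<Sum>j<J. 2 ^ Suc j * (norm (E (dyadic (Suc j)) v))\<^sup>2) \<le> (norm g)\<^sup>2"
proof -
  interpret T: spectral_integral E "\<lambda>t. t powr (1/4)" T by unfold_locales (use T in auto)
  have "2 ^ Suc j * (norm (E (dyadic (Suc j)) v))\<^sup>2 \<le> (norm (E (dyadic (Suc j)) g))\<^sup>2" for j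
  proof -
    define m where "m = sqrt 2 ^ Suc j"
    have m: "m > 0" by (simp add: m_def)
    have m2: "m\<^sup>2 = 2 ^ Suc j" unfolding m_def by (subst power_even_eq[symmetric]) (simp add: power_mult)
    have "m ^ 4 = (m\<^sup>2)\<^sup>2" by simp
    also have "\<dots> = 4 ^ Suc j" unfolding m2 by (simp add: power2_eq_square flip: power_mult_distrib)
    finally have m4: "m ^ 4 = 4 ^ Suc j" .
    have "m * norm (E (dyadic (Suc j)) v) \<le> norm (E (dyadic (Suc j)) g)"
    proof (rule T.norm_E_T_ge[OF vg])
      fix t assume "t \<in> dyadic (Suc j)"
      then have "m ^ 4 \<le> \<bar>t\<bar>" using dyadic_ge[of t "Suc j"] m4 by simp
      then have "(m ^ 4) powr (1/4) \<le> \<bar>t\<bar> powr (1/4)" using m by (intro powr_mono2) auto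
      moreover have "(m ^ 4) powr (1/4) = m"
        using m by (simp add: powr_powr flip: powr_numeral)
      ultimately show "m \<le> t powr (1/4)" by (subst powr_abs_real) simp
    qed simp
    then have "(m * norm (E (dyadic (Suc j)) v))\<^sup>2 \<le> (norm (E (dyadic (Suc j)) g))\<^sup>2"
      using m by (intro power_mono) auto
    then show ?thesis by (simp only: power_mult_distrib m2)
  qed
  then have "(\<Sum>j<J. 2 ^ Suc j * (norm (E (dyadic (Suc j)) v))\<^sup>2) \<le> (\<Sum>j<J. (norm (E (dyadic (Suc j)) g))\<^sup>2)"
    by (rule sum_mono)
  also have "\<dots> \<le> (\<Sum>j<Suc J. (norm (E (dyadic j) g))\<^sup>2)"
    unfolding sum.lessThan_Suc_shift by simp
  also have "\<dots> \<le> (norm g)\<^sup>2"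
    using norm_dyadic_sums[of g] sum_le_suminf[of "\<lambda>j. (norm (E (dyadic j) g))\<^sup>2" "{..<Suc J}"]
    unfolding sums_iff by simp
  finally show ?thesis .
qed

text \<open>Since \<open>s\<close> is multiplied by \<open>\<i>\<close>, the two summands of \<open>w = d + \<i> s v\<close> are orthogonal over every Borel set
  and no sign of the spectrum enters.\<close>

lemma resolvent_bound:
  assumes L: "is_spectral_integral E (\<lambda>t. t) L" and vd: "(v, d) \<in> L" and s: "s > 0"
    and w: "w = d + cscale (\<i> * of_real s) v"
  shows "cmod (cinner d w) \<le> (\<Sum>j. min 1 (4 * 4 ^ j / s) * (norm (E (dyadic j) w))\<^sup>2)"
    and "summable (\<lambda>j. min 1 (4 * 4 ^ j / s) * (norm (E (dyadic j) w))\<^sup>2)"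
proof -
  interpret L: spectral_integral E "\<lambda>t. t" L by unfold_locales (use L in auto)
  let ?t = "\<lambda>j. min 1 (4 * 4 ^ j / s) * (norm (E (dyadic j) w))\<^sup>2"
  have piece: "cmod (cinner (E (dyadic j) d) w) \<le> ?t j" for j
  proof -
    let ?B = "dyadic j"
    have vd': "(E ?B v, E ?B d) \<in> L" by (rule L.T_commute[OF vd]) simp
    have wB: "E ?B w = E ?B d + cscale (\<i> * of_real s) (E ?B v)" by (simp add: w E_add E_cscale)
    have "cinner (E ?B w) (E ?B w) = cinner (E ?B d) (E ?B d) + of_real (s\<^sup>2) * cinner (E ?B v) (E ?B v)
        + \<i> * of_real s * (cinner (E ?B v) (E ?B d) - cinner (E ?B d) (E ?B v))"
      unfolding wB by (simp add: cinner_simps power2_eq_square algebra_simps)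
    also have "cinner (E ?B v) (E ?B d) = cinner (E ?B d) (E ?B v)"
      using L.cinner_real[OF vd'] cinner_commute[of "E ?B v" "E ?B d"] by simp
    finally have "cinner (E ?B w) (E ?B w) = of_real ((norm (E ?B d))\<^sup>2 + s\<^sup>2 * (norm (E ?B v))\<^sup>2)"
      by (simp add: cinner_same)
    then have n: "(norm (E ?B w))\<^sup>2 = (norm (E ?B d))\<^sup>2 + s\<^sup>2 * (norm (E ?B v))\<^sup>2"
      unfolding cinner_same of_real_eq_iff .
    have 1: "norm (E ?B d) \<le> norm (E ?B w)"
      by (rule power2_le_imp_le) (simp_all add: n)
    have "(s * norm (E ?B v))\<^sup>2 \<le> (norm (E ?B w))\<^sup>2" by (simp add: n power_mult_distrib)
    then have 2: "s * norm (E ?B v) \<le> norm (E ?B w)" by (rule power2_le_imp_le) simp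
    have "norm (E ?B d) \<le> (4 * 4 ^ j) * norm (E ?B v)"
      by (rule L.norm_E_T_le[OF vd]) (auto dest: dyadic_le)
    also have "\<dots> = 4 * 4 ^ j / s * (s * norm (E ?B v))" using s by simp
    also have "\<dots> \<le> 4 * 4 ^ j / s * norm (E ?B w)" using s 2 by (intro mult_left_mono) auto
    finally have 3: "norm (E ?B d) \<le> 4 * 4 ^ j / s * norm (E ?B w)" .
    \<comment> \<open>The two arms of the minimum: 1, because \<open>E ?B d\<close> is an orthogonal
      summand of \<open>E ?B w\<close>; \<open>4 * 4 ^ j / s\<close>, from the size of the
      multiplier on the shell and the bound on the other summand.\<close>
    have "norm (E ?B d) \<le> min 1 (4 * 4 ^ j / s) * norm (E ?B w)"
      using 1 3 by (cases "1 \<le> 4 * 4 ^ j / s") (simp_all add: min_def)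
    then have "norm (E ?B d) * norm (E ?B w) \<le> min 1 (4 * 4 ^ j / s) * norm (E ?B w) * norm (E ?B w)"
      by (rule mult_right_mono) simp
    then show ?thesis
      using norm_cinner_le[of "E ?B d" "E ?B w"] by (simp add: cinner_E_idem power2_eq_square mult.assoc)
  qed
  show sum: "summable ?t"
  proof (rule summable_comparison_test)
    show "summable (\<lambda>j. (norm (E (dyadic j) w))\<^sup>2)" using norm_dyadic_sums[of w] by (simp add: sums_iff)
    have "min 1 (4 * 4 ^ j / s) * (norm (E (dyadic j) w))\<^sup>2 \<le> 1 * (norm (E (dyadic j) w))\<^sup>2" for j
      by (intro mult_right_mono) auto
    then show "\<exists>N. \<forall>j\<ge>N. norm (?t j) \<le> (norm (E (dyadic j) w))\<^sup>2"
      using s by (auto simp: abs_mult)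
  qed
  have "(\<lambda>j. cinner (E (dyadic j) d) w) sums cinner d w"
    by (rule bounded_linear.sums[OF bounded_linear_cinner_left dyadic_sums])
  moreover have sn: "summable (\<lambda>j. cmod (cinner (E (dyadic j) d) w))"
    by (rule summable_comparison_test[OF _ sum]) (use piece in auto)
  ultimately have "cmod (cinner d w) \<le> (\<Sum>j. cmod (cinner (E (dyadic j) d) w))"
    using summable_norm[OF sn] by (simp add: sums_iff)
  also have "\<dots> \<le> suminf ?t" by (rule suminf_le[OF piece sn sum])
  finally show "cmod (cinner d w) \<le> suminf ?t" .
qed

text \<open>The sum samples \<open>\<integral> s\<^bsup>-1/2\<^esup> |(L (L + \<i> s)\<^sup>-\<^sup>1 w, w)| ds\<close> at \<open>s = 2 4\<^sup>k\<close>; it is dominated by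
  \<open>\<integral> |t|\<^bsup>1/2\<^esup> d(E w, w)\<close>, which inherits a bound from the \<open>v\<^sub>n\<close>.\<close>

lemma weighted_resolvent_sum_bounded:
  assumes L: "is_spectral_integral E (\<lambda>t. t) L" and T: "is_spectral_integral E (\<lambda>t. t powr (1/4)) T"
    and vg: "\<And>n. (v n, g n) \<in> T" and g: "\<And>n. (norm (g n))\<^sup>2 \<le> C" and lim: "v \<longlonglongrightarrow> w"
    and x: "\<And>k. (x k, d k) \<in> L" "\<And>k. w = d k + cscale (\<i> * of_real (2 * 4 ^ k)) (x k)"
  shows "(\<Sum>k<N. 2 ^ k * cmod (cinner (d k) w)) \<le> 4 * ((norm w)\<^sup>2 + C)"
proof -
  define a where "a j = (norm (E (dyadic j) w))\<^sup>2" for j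
  \<comment> \<open>Finitely many shells pass to the limit because each projection is continuous;
    the bound \<open>C\<close> is uniform in \<open>J\<close>.\<close>
  have w_bound: "(\<Sum>j<J. 2 ^ Suc j * a (Suc j)) \<le> C" for J
  proof (rule LIMSEQ_le_const2)
    show "(\<lambda>n. \<Sum>j<J. 2 ^ Suc j * (norm (E (dyadic (Suc j)) (v n)))\<^sup>2) \<longlonglongrightarrow> (\<Sum>j<J. 2 ^ Suc j * a (Suc j))"
      unfolding a_def by (intro tendsto_intros tendsto_E lim) auto
    show "\<exists>M. \<forall>n\<ge>M. (\<Sum>j<J. 2 ^ Suc j * (norm (E (dyadic (Suc j)) (v n)))\<^sup>2) \<le> C"
      using fourth_root_oper_ge[OF T vg] g order_trans by blast
  qed
  \<comment> \<open>Restores shell 0, which contributes at most the squared norm of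
    \<open>w\<close>.\<close>
  have w_bound': "(\<Sum>j<J. 2 ^ j * a j) \<le> (norm w)\<^sup>2 + C" for J
  proof -
    have "a 0 \<le> (norm w)\<^sup>2" unfolding a_def by (intro power_mono norm_E_le) auto
    then have "(\<Sum>j<Suc J. 2 ^ j * a j) \<le> (norm w)\<^sup>2 + C"
      using w_bound[of J] unfolding sum.lessThan_Suc_shift by simp
    moreover have "0 \<le> 2 ^ J * a J" by (simp add: a_def)
    ultimately show ?thesis by simp
  qed
  \<comment> \<open>The minimum of \<open>resolvent_bound\<close> at
    \<open>s = 2 * 4 ^ k\<close>.\<close>
  let ?m = "\<lambda>k j. min 1 (2 * 4 ^ j / 4 ^ k :: real)"
  have b: "cmod (cinner (d k) w) \<le> (\<Sum>j. ?m k j * a j)" and sm: "summable (\<lambda>j. ?m k j * a j)" for k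
    using resolvent_bound[OF L x(1) _ x(2), of k] by (simp_all add: a_def)
  have "(\<Sum>k<N. 2 ^ k * cmod (cinner (d k) w)) \<le> (\<Sum>k<N. \<Sum>j. 2 ^ k * (?m k j * a j))"
    by (intro sum_mono) (simp add: suminf_mult sm b)
  \<comment> \<open>Summing over \<open>k\<close> first collapses the kernel to at most
    \<open>4 * 2 ^ j\<close> on shell \<open>j\<close>, the weight controlled by
    \<open>w_bound'\<close>.\<close>
  also have "\<dots> = (\<Sum>j. \<Sum>k<N. 2 ^ k * (?m k j * a j))"
    by (intro suminf_sum[symmetric] summable_mult sm)
  also have "\<dots> \<le> 4 * ((norm w)\<^sup>2 + C)"
  proof (rule suminf_le_const)
    show "summable (\<lambda>j. \<Sum>k<N. 2 ^ k * (?m k j * a j))" by (intro summable_sum summable_mult sm)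
    fix J
    have "(\<Sum>j<J. \<Sum>k<N. 2 ^ k * (?m k j * a j)) = (\<Sum>j<J. (\<Sum>k<N. 2 ^ k * ?m k j) * a j)"
      by (simp add: sum_distrib_right mult.assoc)
    also have "\<dots> \<le> (\<Sum>j<J. (4 * 2 ^ j) * a j)"
      by (intro sum_mono mult_right_mono dyadic_kernel_sum) (simp add: a_def)
    also have "\<dots> = 4 * (\<Sum>j<J. 2 ^ j * a j)" by (simp add: sum_distrib_left mult.assoc)
    also have "\<dots> \<le> 4 * ((norm w)\<^sup>2 + C)" using w_bound'[of J] by simp
    finally show "(\<Sum>j<J. \<Sum>k<N. 2 ^ k * (?m k j * a j)) \<le> 4 * ((norm w)\<^sup>2 + C)" .
  qed
  finally show ?thesis .
qed

end

section \<open>Test functions and weak derivatives\<close>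

lemma square_integrable_rep: "square_integrable (rep_L2 u)"
  using Quotient_rep_reflp[OF Quotient_L2, of u] by (simp add: L2_eq_def)

lemma abs_rep_L2 [simp]: "abs_L2 (rep_L2 u) = u"
  by (rule Quotient_abs_rep[OF Quotient_L2])

lemma rep_abs_L2:
  assumes "square_integrable f"
  shows "AE x in lborel. rep_L2 (abs_L2 f) x = f x"
proof -
  have "L2_eq f f" using assms by (simp add: L2_eq_def)
  then have "L2_eq (rep_L2 (abs_L2 f)) f" by (rule Quotient_rep_abs[OF Quotient_L2])
  then show ?thesis by (simp add: L2_eq_def)
qed

lemma cinner_abs_abs:
  assumes "square_integrable f" "square_integrable g"
  shows "cinner (abs_L2 f) (abs_L2 g) = (LINT x|lborel. f x * cnj (g x))"
  by (rule cinner.abs_eq) (use assms in \<open>simp_all add: L2_eq_def\<close>)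

lemma cinner_abs_right:
  "square_integrable g \<Longrightarrow> cinner u (abs_L2 g) = (LINT x|lborel. rep_L2 u x * cnj (g x))"
  using cinner_abs_abs[OF square_integrable_rep, of g u] by simp

lemma rep_L2_plus: "AE x in lborel. rep_L2 (u + v) x = rep_L2 u x + rep_L2 v x"
proof -
  have "abs_L2 (\<lambda>x. rep_L2 u x + rep_L2 v x) = abs_L2 (rep_L2 u) + abs_L2 (rep_L2 v)"
    by (rule plus_L2.abs_eq[symmetric]) (simp_all add: L2_eq_def square_integrable_rep)
  then show ?thesis
    using rep_abs_L2[OF square_integrable_add[OF square_integrable_rep square_integrable_rep], of u v] by simp
qed

lemma rep_L2_cscale: "AE x in lborel. rep_L2 (cscale a u) x = a * rep_L2 u x"
proof -
  have "abs_L2 (\<lambda>x. a * rep_L2 u x) = cscale a (abs_L2 (rep_L2 u))"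
    by (rule cscale.abs_eq[symmetric]) (simp add: L2_eq_def square_integrable_rep)
  then show ?thesis
    using rep_abs_L2[OF square_integrable_mult[OF square_integrable_rep], of a u] by simp
qed

lemma rep_L2_measurable [measurable]: "rep_L2 u \<in> borel_measurable borel"
  using square_integrable_rep[of u] by (simp add: square_integrable_def)

lemma L2_eq_0I:
  assumes "AE x in lborel. rep_L2 u x = 0"
  shows "u = 0"
proof -
  have "cinner u v = 0" for v
  proof -
    have "cinner u v = (LINT x|lborel. rep_L2 u x * cnj (rep_L2 v x))"
      using cinner_abs_right[OF square_integrable_rep, of u v] by simp
    also have "\<dots> = 0" using assms by (intro integral_eq_zero_AE) auto
    finally show ?thesis .
  qed
  then show ?thesis by (intro L2_eqI) simp
qed

lemma test_fun_DERIV: "test_fun \<eta> \<Longrightarrow> (\<eta> has_real_derivative deriv \<eta> x) (at x)"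
proof -
  assume "test_fun \<eta>"
  then have "(deriv ^^ 0) \<eta> differentiable at x" unfolding test_fun_def by blast
  then show ?thesis using DERIV_deriv_iff_real_differentiable by auto
qed

lemma continuous_on_test_fun: "test_fun \<eta> \<Longrightarrow> continuous_on A \<eta>"
  by (meson test_fun_DERIV DERIV_continuous_on has_field_derivative_at_within)

lemma test_fun_support:
  assumes "test_fun \<eta>"
  obtains M where "M > 0" "\<And>x. M \<le> \<bar>x\<bar> \<Longrightarrow> \<eta> x = 0"
proof -
  have "bounded {x. \<eta> x \<noteq> 0}"
    using assms compact_imp_bounded bounded_subset closure_subset unfolding test_fun_def by metis
  then obtain M where M: "\<And>x. \<eta> x \<noteq> 0 \<Longrightarrow> \<bar>x\<bar> \<le> M" by (auto simp: bounded_iff)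
  show thesis by (rule that[of "\<bar>M\<bar> + 1"]) (use M in fastforce)+
qed

lemma test_fun_deriv:
  assumes "test_fun \<eta>"
  shows "test_fun (deriv \<eta>)"
proof -
  let ?K = "closure {x. \<eta> x \<noteq> 0}"
  have "deriv \<eta> x = 0" if "x \<notin> ?K" for x
  proof -
    have "\<forall>\<^sub>F y in nhds x. y \<in> - ?K" using that by (intro eventually_nhds_in_open) auto
    then have "\<forall>\<^sub>F y in nhds x. \<eta> y = 0"
      using closure_subset[of "{x. \<eta> x \<noteq> 0}"] by (auto elim!: eventually_mono)
    then show ?thesis by (simp add: deriv_cong_ev[where g = "\<lambda>_. 0"])
  qed
  then have "{x. deriv \<eta> x \<noteq> 0} \<subseteq> ?K" by auto
  moreover have "bounded ?K" using assms by (auto simp: test_fun_def compact_imp_bounded)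
  ultimately have "compact (closure {x. deriv \<eta> x \<noteq> 0})"
    unfolding compact_closure by (rule bounded_subset[rotated])
  moreover have "(deriv ^^ n) (deriv \<eta>) differentiable at x" for n x
    using assms unfolding test_fun_def by (metis funpow_swap1 funpow_simps_right(2) comp_apply)
  ultimately show ?thesis by (simp add: test_fun_def)
qed

lemma square_integrable_test_fun:
  assumes "test_fun \<eta>"
  shows "square_integrable (\<lambda>x. of_real (\<eta> x))"
proof -
  obtain M where M: "\<And>x. M \<le> \<bar>x\<bar> \<Longrightarrow> \<eta> x = 0" using test_fun_support[OF assms] by blast
  have c: "continuous_on UNIV \<eta>" by (rule continuous_on_test_fun[OF assms])
  then have [measurable]: "\<eta> \<in> borel_measurable borel" by (rule borel_measurable_continuous_onI)
  have "integrable lborel (\<lambda>x. indicator {-M..M} x *\<^sub>R (\<eta> x)\<^sup>2)"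
    by (rule borel_integrable_compact) (auto intro: continuous_on_power[OF continuous_on_test_fun[OF assms]])
  also have "(\<lambda>x. indicator {-M..M} x *\<^sub>R (\<eta> x)\<^sup>2) = (\<lambda>x. (\<eta> x)\<^sup>2)"
  proof
    fix x
    show "indicator {-M..M} x *\<^sub>R (\<eta> x)\<^sup>2 = (\<eta> x)\<^sup>2"
      by (cases "x \<in> {-M..M}") (use M[of x] in auto)
  qed
  finally show ?thesis by (simp add: square_integrable_def)
qed

definition test_vec :: "(real \<Rightarrow> real) \<Rightarrow> L2" where
  "test_vec \<eta> = abs_L2 (\<lambda>x. of_real (\<eta> x))"

lemma cinner_test_vec: "test_fun \<eta> \<Longrightarrow> cinner u (test_vec \<eta>) = (LINT x|lborel. rep_L2 u x * of_real (\<eta> x))"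
  unfolding test_vec_def by (simp add: cinner_abs_right square_integrable_test_fun)

text \<open>Replaces integrals of representatives by inner products, so that weak derivatives of
  linear combinations follow by algebra.\<close>

lemma has_weak_deriv_iff:
  "has_weak_deriv u w \<longleftrightarrow>
     (\<forall>\<eta>. test_fun \<eta> \<longrightarrow> cinner u (test_vec (deriv \<eta>)) = - cinner w (test_vec \<eta>))"
  by (auto simp: has_weak_deriv_def cinner_test_vec test_fun_deriv)

section \<open>Smooth bumps approximating indicators of intervals\<close>

definition flat :: "nat \<Rightarrow> real \<Rightarrow> real" where
  "flat m x = (if x > 0 then (1 / x) ^ m * exp (- (1 / x)) else 0)"

lemma power_le_fact_exp: "0 \<le> y \<Longrightarrow> y ^ m \<le> fact m * exp (y::real)"
proof -
  assume y: "0 \<le> y"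
  have s: "(\<lambda>n. y ^ n /\<^sub>R fact n) sums exp y" by (rule exp_converges)
  have "(\<Sum>n\<in>{m}. y ^ n /\<^sub>R fact n) \<le> (\<Sum>n. y ^ n /\<^sub>R fact n)"
    using s y by (intro sum_le_suminf) (auto simp: sums_iff)
  then have "y ^ m / fact m \<le> exp y" using s by (simp add: sums_iff divide_inverse mult.commute)
  then show ?thesis by (simp add: field_simps)
qed

text \<open>With \<open>y = 1 / x\<close>, the exponential series dominates
  \<open>y ^ (m + 2)\<close>. Quadratic decay at 0 is what makes the difference quotient of
  \<open>flat m\<close> vanish there.\<close>

lemma flat_le: "\<bar>flat m x\<bar> \<le> fact (m + 2) * x\<^sup>2"
proof (cases "x > 0")
  case True
  then have "(1 / x) ^ (m + 2) \<le> fact (m + 2) * exp (1 / x)" by (intro power_le_fact_exp) simp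
  then have "(1 / x) ^ (m + 2) * exp (- (1 / x)) * x\<^sup>2 \<le> fact (m + 2) * exp (1 / x) * exp (- (1 / x)) * x\<^sup>2"
    by (intro mult_right_mono) auto
  moreover have "(1 / x) ^ (m + 2) * exp (- (1 / x)) * x\<^sup>2 = flat m x"
    using True by (simp add: flat_def power_add power2_eq_square)
  moreover have "exp (1 / x) * exp (- (1 / x)) = 1" by (simp flip: exp_add)
  ultimately show ?thesis using True by (simp add: flat_def mult.assoc)
qed (simp add: flat_def)

lemma flat_DERIV: "(flat m has_real_derivative flat (m + 2) x - real m * flat (m + 1) x) (at x)"
proof (cases x "0 :: real" rule: linorder_cases)
  case less
  have "(flat m has_real_derivative 0) (at x)"
  proof (rule has_field_derivative_transform_within_open)
    show "((\<lambda>_. 0) has_real_derivative 0) (at x)" by simp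
    show "open {..<0::real}" by simp
  qed (use less in \<open>auto simp: flat_def\<close>)
  then show ?thesis using less by (simp add: flat_def)
next
  case equal
  have "((\<lambda>h. flat m h / h) \<longlongrightarrow> 0) (at 0)"
  proof (rule Lim_null_comparison)
    show "((\<lambda>h::real. fact (m + 2) * \<bar>h\<bar>) \<longlongrightarrow> 0) (at 0)"
      by (rule tendsto_eq_intros refl | simp)+
    have "norm (flat m h / h) \<le> fact (m + 2) * \<bar>h\<bar>" if "h \<noteq> 0" for h
      using flat_le[of m h] that by (simp add: divide_le_eq power2_eq_square mult.assoc abs_mult_self_eq)
    then show "\<forall>\<^sub>F h in at 0. norm (flat m h / h) \<le> fact (m + 2) * \<bar>h\<bar>"
      by (auto simp: eventually_at_filter)
  qed
  then show ?thesis using equal by (simp add: DERIV_def flat_def)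
next
  case greater
  have "(flat m has_real_derivative flat (m + 2) x - real m * flat (m + 1) x) (at x)"
  proof (rule has_field_derivative_transform_within_open)
    show "((\<lambda>x. (1 / x) ^ m * exp (- (1 / x))) has_real_derivative
        flat (m + 2) x - real m * flat (m + 1) x) (at x)"
    proof (rule DERIV_cong)
      show "((\<lambda>x. (1 / x) ^ m * exp (- (1 / x))) has_real_derivative
          real m * (- (1 / x\<^sup>2) * (1 / x) ^ (m - Suc 0)) * exp (- (1 / x)) +
          exp (- (1 / x)) * (1 / x\<^sup>2) * (1 / x) ^ m) (at x)"
        using greater by (auto intro!: derivative_eq_intros simp: power2_eq_square)
      show "real m * (- (1 / x\<^sup>2) * (1 / x) ^ (m - Suc 0)) * exp (- (1 / x)) +
          exp (- (1 / x)) * (1 / x\<^sup>2) * (1 / x) ^ m = flat (m + 2) x - real m * flat (m + 1) x"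
        using greater by (cases m) (simp_all add: flat_def power2_eq_square mult_ac)
    qed
    show "open {0::real<..}" by simp
  qed (use greater in \<open>auto simp: flat_def\<close>)
  then show ?thesis .
qed

text \<open>The linear span of products of two flat factors. By \<open>flat_DERIV\<close> and the
  product rule it is closed under differentiation, which yields derivatives of all orders by
  induction.\<close>

inductive_set bumps :: "real \<Rightarrow> real \<Rightarrow> real \<Rightarrow> (real \<Rightarrow> real) set" for s a b where
  prod: "(\<lambda>x. flat i (s * (x - a)) * flat j (s * (b - x))) \<in> bumps s a b"
| add: "f \<in> bumps s a b \<Longrightarrow> g \<in> bumps s a b \<Longrightarrow> (\<lambda>x. f x + g x) \<in> bumps s a b"
| scale: "f \<in> bumps s a b \<Longrightarrow> (\<lambda>x. r * f x) \<in> bumps s a b"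

lemma bumps_DERIV:
  assumes "f \<in> bumps s a b"
  shows "\<exists>g\<in>bumps s a b. \<forall>x. (f has_real_derivative g x) (at x)"
  using assms
proof induction
  case (prod i j)
  let ?p = "\<lambda>i j x. flat i (s * (x - a)) * flat j (s * (b - x))"
  let ?g = "\<lambda>x. (s * ?p (i + 2) j x + (- s * real i) * ?p (i + 1) j x) +
    ((- s) * ?p i (j + 2) x + (s * real j) * ?p i (j + 1) x)"
  have "?g \<in> bumps s a b" by (intro bumps.intros)
  moreover have "(?p i j has_real_derivative ?g x) (at x)" for x
    by (rule derivative_eq_intros DERIV_chain2[OF flat_DERIV] refl)+ (simp add: algebra_simps)
  ultimately show ?case by (intro bexI[of _ ?g] allI)
next
  case (add f1 f2)
  then obtain g1 g2 where g: "g1 \<in> bumps s a b" "g2 \<in> bumps s a b"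
    and "\<And>x. (f1 has_real_derivative g1 x) (at x)" "\<And>x. (f2 has_real_derivative g2 x) (at x)" by blast
  then have "\<And>x. ((\<lambda>x. f1 x + f2 x) has_real_derivative g1 x + g2 x) (at x)"
    by (intro derivative_intros)
  with bumps.add[OF g] show ?case by (intro bexI[of _ "\<lambda>x. g1 x + g2 x"] allI)
next
  case (scale f r)
  then obtain g where g: "g \<in> bumps s a b" and "\<And>x. (f has_real_derivative g x) (at x)" by blast
  then have "\<And>x. ((\<lambda>x. r * f x) has_real_derivative r * g x) (at x)"
    by (intro DERIV_cmult)
  with bumps.scale[OF g] show ?case by (intro bexI[of _ "\<lambda>x. r * g x"] allI)
qed

lemma bumps_smooth:
  assumes "f \<in> bumps s a b"
  shows "(deriv ^^ n) f differentiable at x"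
proof -
  have "(deriv ^^ n) f \<in> bumps s a b"
  proof (induction n)
    case (Suc n)
    then obtain g where "g \<in> bumps s a b" "\<And>x. ((deriv ^^ n) f has_real_derivative g x) (at x)"
      using bumps_DERIV by blast
    moreover from this(2) have "deriv ((deriv ^^ n) f) = g" using DERIV_imp_deriv by blast
    ultimately show ?case by simp
  qed (use assms in simp)
  then show ?thesis using bumps_DERIV real_differentiable_def by blast
qed

text \<open>The factor \<open>Suc n\<close> steepens both edges, so the bumps converge pointwise to
  the indicator of the open interval; \<open>Suc\<close> keeps the scale positive.\<close>

definition bump :: "nat \<Rightarrow> real \<Rightarrow> real \<Rightarrow> real \<Rightarrow> real" where
  "bump n a b x = flat 0 (real (Suc n) * (x - a)) * flat 0 (real (Suc n) * (b - x))"

lemma bump_eq_0: "x \<notin> {a<..<b} \<Longrightarrow> bump n a b x = 0"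
  by (auto simp: bump_def flat_def zero_less_mult_iff)

lemma test_fun_bump: "test_fun (bump n a b)"
proof -
  have "{x. bump n a b x \<noteq> 0} \<subseteq> {a<..<b}" using bump_eq_0[of _ a b n] by blast
  then have "compact (closure {x. bump n a b x \<noteq> 0})"
    unfolding compact_closure by (rule bounded_subset[rotated]) simp
  moreover have "bump n a b \<in> bumps (real (Suc n)) a b"
    unfolding bump_def[abs_def] by (rule bumps.prod)
  ultimately show ?thesis by (simp add: test_fun_def bumps_smooth)
qed

lemma bump_le_indicator: "\<bar>bump n a b x\<bar> \<le> indicator {a..b} x"
proof (cases "x \<in> {a<..<b}")
  case True
  have "\<bar>flat 0 y\<bar> \<le> 1" for y by (simp add: flat_def)
  then have "\<bar>bump n a b x\<bar> \<le> 1 * 1" unfolding bump_def abs_mult by (intro mult_mono) auto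
  then show ?thesis using True by simp
qed (simp add: bump_eq_0)

lemma bump_tendsto: "(\<lambda>n. bump n a b x) \<longlonglongrightarrow> indicator {a<..<b} x"
proof (cases "x \<in> {a<..<b}")
  case True
  have *: "(\<lambda>n. flat 0 (real (Suc n) * y)) \<longlonglongrightarrow> 1" if "y > 0" for y
  proof -
    have "(\<lambda>n. exp (- ((1 / y) * inverse (real (Suc n))))) \<longlonglongrightarrow> exp (- ((1 / y) * 0))"
      by (intro tendsto_intros LIMSEQ_inverse_real_of_nat)
    moreover have "exp (- ((1 / y) * inverse (real (Suc n)))) = flat 0 (real (Suc n) * y)" for n
      using that by (simp add: flat_def divide_inverse mult.commute)
    ultimately show ?thesis by simp
  qed
  have "(\<lambda>n. bump n a b x) \<longlonglongrightarrow> 1 * 1"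
    unfolding bump_def using True by (intro tendsto_mult *) auto
  then show ?thesis using True by simp
qed (simp add: bump_eq_0)

section \<open>Fundamental lemma of the calculus of variations and uniqueness of weak
  derivatives\<close>

lemma AE_zero_if_tail_integrals_zero:
  fixes f :: "real \<Rightarrow> real"
  assumes f: "integrable lborel f" and 0: "\<And>a. (LINT x|lborel. indicator {a<..} x * f x) = 0"
  shows "AE x in lborel. f x = 0"
proof -
  have [measurable]: "f \<in> borel_measurable borel" using f by auto
  let ?p = "\<lambda>x. ennreal (f x)" and ?n = "\<lambda>x. ennreal (- f x)"
  have em: "emeasure (density lborel (\<lambda>x. ennreal (g x))) {a<..} = ennreal (LINT x|lborel. indicator {a<..} x * max 0 (g x))"
    if g: "integrable lborel g" for a and g :: "real \<Rightarrow> real"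
  proof -
    have [measurable]: "g \<in> borel_measurable borel" using g by auto
    have "emeasure (density lborel (\<lambda>x. ennreal (g x))) {a<..} = (\<integral>\<^sup>+x. ennreal (indicator {a<..} x * max 0 (g x)) \<partial>lborel)"
      by (subst emeasure_density)
         (auto intro!: nn_integral_cong simp: max_def ennreal_neg split: split_indicator)
    also have "\<dots> = ennreal (LINT x|lborel. indicator {a<..} x * max 0 (g x))"
      by (rule nn_integral_eq_integral)
         (auto intro!: integrable_mult_indicator[where 'b = real, simplified] integrable_max g)
    finally show ?thesis .
  qed
  \<comment> \<open>The positive and negative parts of \<open>f\<close> define finite measures that
    agree on all half-lines, hence coincide, and so do their densities almost everywhere.\<close>
  have "density lborel ?p = density lborel ?n"
  proof (rule measure_eqI_lessThan)
    fix a
    have i: "integrable lborel (\<lambda>x. indicator {a<..} x * max 0 (f x))" "integrable lborel (\<lambda>x. indicator {a<..} x * max 0 (- f x))"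
      by (auto intro!: integrable_mult_indicator[where 'b = real, simplified] integrable_max f)
    have "(LINT x|lborel. indicator {a<..} x * max 0 (f x)) - (LINT x|lborel. indicator {a<..} x * max 0 (- f x))
        = (LINT x|lborel. indicator {a<..} x * f x)"
      by (subst Bochner_Integration.integral_diff[OF i, symmetric])
         (auto intro!: Bochner_Integration.integral_cong simp: max_def split: split_indicator)
    then show "emeasure (density lborel ?p) {a<..} = emeasure (density lborel ?n) {a<..}"
      using 0[of a] f by (simp add: em)
    show "emeasure (density lborel ?p) {a<..} < \<infinity>" using f by (simp add: em)
  qed auto
  moreover have "integral\<^sup>N lborel ?p \<noteq> \<infinity>"
    using f by (auto simp: real_integrable_def)
  ultimately have "AE x in lborel. ?p x = ?n x"
    by (intro finite_density_unique[THEN iffD1]) auto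
  then show ?thesis
  proof eventually_elim
    case (elim x)
    then show ?case by (cases "f x \<ge> 0") (auto simp: ennreal_neg ennreal_eq_0_iff dest: sym)
  qed
qed

text \<open>Bumps are test functions that converge to indicators, so by dominated convergence the
  integral over every bounded open interval vanishes.\<close>

lemma fundamental_lemma:
  assumes "\<And>\<eta>. test_fun \<eta> \<Longrightarrow> cinner u (test_vec \<eta>) = 0"
  shows "u = 0"
proof -
  let ?f = "rep_L2 u"
  \<comment> \<open>A square integrable function is locally integrable, as its modulus is at most 1
    plus its square.\<close>
  have loc: "integrable lborel (\<lambda>x. indicator {a..b} x *\<^sub>R ?f x)" for a b
  proof -
    have "integrable lborel (\<lambda>x. indicator {a..b} x + (cmod (?f x))\<^sup>2 :: real)"
      using square_integrable_rep[of u]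
      by (intro Bochner_Integration.integrable_add) (auto simp: square_integrable_def emeasure_lborel_Icc_eq)
    moreover have "norm (indicator {a..b} x *\<^sub>R ?f x) \<le> indicator {a..b} x + (cmod (?f x))\<^sup>2" for x
      using sum_squares_bound[of 1 "cmod (?f x)"] norm_ge_zero[of "?f x"]
      by (auto split: split_indicator simp del: norm_ge_zero)
    ultimately show ?thesis
      by (elim Bochner_Integration.integrable_bound) (auto intro!: AE_I2 elim: order_trans simp: abs_of_nonneg)
  qed
  have 0: "(LINT x|lborel. indicator {a<..<b} x *\<^sub>R ?f x) = 0" for a b
  proof -
    have "(\<lambda>n. LINT x|lborel. ?f x * of_real (bump n a b x)) \<longlonglongrightarrow> (LINT x|lborel. indicator {a<..<b} x *\<^sub>R ?f x)"
    proof (rule integral_dominated_convergence)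
      show "integrable lborel (\<lambda>x. norm (indicator {a..b} x *\<^sub>R ?f x))" by (intro integrable_norm loc)
      have [measurable]: "bump n a b \<in> borel_measurable borel" for n
        by (intro borel_measurable_continuous_onI continuous_on_test_fun test_fun_bump)
      show "(\<lambda>x. ?f x * of_real (bump n a b x)) \<in> borel_measurable lborel" for n by measurable
      show "(\<lambda>x. indicator {a<..<b} x *\<^sub>R ?f x) \<in> borel_measurable lborel" by measurable
      have "(\<lambda>n. ?f x * of_real (bump n a b x)) \<longlonglongrightarrow> ?f x * of_real (indicator {a<..<b} x)" for x
        by (intro tendsto_intros bump_tendsto)
      then show "AE x in lborel. (\<lambda>n. ?f x * of_real (bump n a b x)) \<longlonglongrightarrow> indicator {a<..<b} x *\<^sub>R ?f x"
        by (simp add: scaleR_conv_of_real mult.commute)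
      have "cmod (?f x) * \<bar>bump n a b x\<bar> \<le> cmod (?f x) * indicator {a..b} x" for x n
        by (intro mult_left_mono bump_le_indicator) simp
      then show "AE x in lborel. norm (?f x * of_real (bump n a b x)) \<le> norm (indicator {a..b} x *\<^sub>R ?f x)" for n
        by (simp add: norm_mult mult.commute)
    qed
    moreover have "(LINT x|lborel. ?f x * of_real (bump n a b x)) = 0" for n
      using assms[OF test_fun_bump] by (simp add: cinner_test_vec test_fun_bump)
    ultimately show ?thesis by (simp add: LIMSEQ_const_iff)
  qed
  \<comment> \<open>\<open>p\<close> will be \<open>Re\<close> or \<open>Im\<close>. The cutoff to a
    bounded interval provides integrability and turns each tail integral into one over a bounded
    interval.\<close>
  have part: "AE x in lborel. indicator {- real N<..<real N} x * p (?f x) = 0"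
    if p: "bounded_linear p" for N and p :: "complex \<Rightarrow> real"
  proof (rule AE_zero_if_tail_integrals_zero)
    have i: "integrable lborel (\<lambda>x. indicator {a<..<b} x *\<^sub>R ?f x)" for a b
    proof -
      have "integrable lborel (\<lambda>x. indicator {a<..<b} x *\<^sub>R (indicator {a..b} x *\<^sub>R ?f x))"
        by (intro integrable_mult_indicator loc) auto
      also have "(\<lambda>x. indicator {a<..<b} x *\<^sub>R (indicator {a..b} x *\<^sub>R ?f x)) = (\<lambda>x. indicator {a<..<b} x *\<^sub>R ?f x)"
        by (auto simp: fun_eq_iff split: split_indicator)
      finally show ?thesis .
    qed
    have ps: "p (r *\<^sub>R z) = r * p z" for r z
      using p by (simp add: bounded_linear.linear linear_scale)
    show "integrable lborel (\<lambda>x. indicator {- real N<..<real N} x * p (?f x))"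
      using integrable_bounded_linear[OF p i, of "- real N" "real N"] by (simp add: ps)
    fix a
    have "(LINT x|lborel. indicator {a<..} x * (indicator {- real N<..<real N} x * p (?f x)))
        = (LINT x|lborel. p (indicator {max a (- real N)<..<real N} x *\<^sub>R ?f x))"
      by (intro Bochner_Integration.integral_cong) (auto simp: ps split: split_indicator)
    also have "\<dots> = 0"
      using integral_bounded_linear[OF p i, of "max a (- real N)" "real N"] 0 p
      by (simp add: bounded_linear.linear linear_0)
    finally show "(LINT x|lborel. indicator {a<..} x * (indicator {- real N<..<real N} x * p (?f x))) = 0" .
  qed
  have "AE x in lborel. \<forall>N. indicator {- real N<..<real N} x * Re (?f x) = 0"
    "AE x in lborel. \<forall>N. indicator {- real N<..<real N} x * Im (?f x) = 0"
    by (simp_all only: AE_all_countable part bounded_linear_Re bounded_linear_Im simp_thms)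
  then have "AE x in lborel. ?f x = 0"
  proof eventually_elim
    case (elim x)
    obtain N where "\<bar>x\<bar> < real N" using reals_Archimedean2 by blast
    then have "indicator {- real N<..<real N} x = (1::real)" by (simp add: abs_less_iff)
    then show ?case using elim(1)[THEN spec, of N] elim(2)[THEN spec, of N] by (simp add: complex_eq_iff)
  qed
  then show ?thesis by (rule L2_eq_0I)
qed

lemma weak_deriv_eq:
  assumes "has_weak_deriv u w"
  shows "weak_deriv u = w"
  unfolding weak_deriv_def
proof (rule the_equality[where P = "has_weak_deriv u", OF assms])
  fix w' assume "has_weak_deriv u w'"
  with assms have "cinner (w' - w) (test_vec \<eta>) = 0" if "test_fun \<eta>" for \<eta>
    using that by (simp add: has_weak_deriv_iff cinner_diff_left)
  then have "w' - w = 0" by (rule fundamental_lemma)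
  then show "w' = w" by simp
qed

section \<open>Exponentials on half-lines\<close>

definition half_exp :: "complex \<Rightarrow> real \<Rightarrow> complex" where
  "half_exp a x = (if x > 0 then exp (- (a * of_real x)) else 0)"

lemma half_exp_measurable [measurable]: "half_exp a \<in> borel_measurable borel"
proof -
  have [measurable]: "(\<lambda>x::real. exp (- (a * of_real x))) \<in> borel_measurable borel"
    by (intro borel_measurable_continuous_onI continuous_intros)
  show ?thesis unfolding half_exp_def[abs_def] by measurable
qed

lemma exp_vector_derivative:
  "((\<lambda>x. exp (- (a * of_real x))) has_vector_derivative - (a * exp (- (a * of_real x)))) (at x within S)"
  for a :: complex
  by (rule has_vector_derivative_real_field[of "\<lambda>z. exp (- (a * z))"])
     (auto intro!: derivative_eq_intros)

lemma norm_half_exp: "cmod (half_exp a x) = indicator {0<..} x * exp (- (Re a * x))"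
  by (simp add: half_exp_def)

lemma exp_decay: "(r::real) > 0 \<Longrightarrow> ((\<lambda>x. exp (- (r * x))) \<longlongrightarrow> 0) at_top"
  by (intro filterlim_compose[OF exp_at_bot] filterlim_compose[OF filterlim_uminus_at_bot_at_top]
      filterlim_tendsto_pos_mult_at_top[OF tendsto_const] filterlim_ident)

lemma integrable_half_exp:
  assumes "Re a > 0"
  shows "integrable lborel (half_exp a)"
proof (rule integrableI_bounded)
  let ?r = "Re a"
  have "((\<lambda>x. - exp (- (?r * x)) / ?r) \<longlongrightarrow> 0) at_top"
    using tendsto_divide[OF tendsto_minus[OF exp_decay[OF assms]] tendsto_const[of ?r]] assms by simp
  then have "(\<integral>\<^sup>+x. ennreal (exp (- (?r * x))) * indicator {0..} x \<partial>lborel) = 0 - (- exp (- (?r * 0)) / ?r)"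
    by (intro nn_integral_FTC_atLeast) (use assms in \<open>auto intro!: derivative_eq_intros\<close>)
  moreover have "(\<integral>\<^sup>+x. ennreal (norm (half_exp a x)) \<partial>lborel) \<le> (\<integral>\<^sup>+x. ennreal (exp (- (?r * x))) * indicator {0..} x \<partial>lborel)"
    by (intro nn_integral_mono) (auto simp: norm_half_exp split: split_indicator)
  ultimately show "(\<integral>\<^sup>+x. ennreal (norm (half_exp a x)) \<partial>lborel) < \<infinity>"
    by (auto simp: less_top intro: le_less_trans)
qed simp

lemma integral_half_exp:
  assumes a: "Re a > 0"
  shows "(LINT x|lborel. half_exp a x) = 1 / a"
proof -
  have a0: "a \<noteq> 0" using a by auto
  let ?s = "\<lambda>n x. indicator {0..real n} x *\<^sub>R exp (- (a * of_real x))"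
  have "(\<lambda>n. LINT x|lborel. ?s n x) \<longlonglongrightarrow> (LINT x|lborel. half_exp a x)"
  proof (rule integral_dominated_convergence)
    show "integrable lborel (\<lambda>x. norm (half_exp a x))" using a by (intro integrable_norm integrable_half_exp)
    have [measurable]: "(\<lambda>x::real. exp (- (a * of_real x))) \<in> borel_measurable borel"
      by (intro borel_measurable_continuous_onI continuous_intros)
    show "?s n \<in> borel_measurable lborel" for n by measurable
    \<comment> \<open>The point 0 is exceptional: there \<open>half_exp a\<close> is 0, while the
      truncation is 1.\<close>
    have "(\<lambda>n. ?s n x) \<longlonglongrightarrow> half_exp a x" if "x \<noteq> 0" for x
    proof (rule tendsto_eventually)
      obtain N where N: "x \<le> real N" using real_arch_simple by blast
      show "\<forall>\<^sub>F n in sequentially. ?s n x = half_exp a x"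
        using eventually_ge_at_top[of N]
      proof eventually_elim
        case (elim n)
        then have "x \<le> real n" using N by linarith
        then show ?case using that by (auto simp: half_exp_def split: split_indicator)
      qed
    qed
    then show "AE x in lborel. (\<lambda>n. ?s n x) \<longlonglongrightarrow> half_exp a x"
      using AE_lborel_singleton[of 0] by (auto elim!: eventually_mono)
    have "norm (?s n x) \<le> norm (half_exp a x)" if "x \<noteq> 0" for n x
      using that by (auto simp: half_exp_def split: split_indicator)
    then show "AE x in lborel. norm (?s n x) \<le> norm (half_exp a x)" for n
      using AE_lborel_singleton[of 0] by (auto elim!: eventually_mono)
  qed simp
  moreover have "(LINT x|lborel. ?s n x) = 1 / a - exp (- (a * of_real n)) / a" for n
  proof -
    have "(LINT x|lborel. ?s n x) = - exp (- (a * of_real (real n))) / a - (- exp (- (a * of_real 0)) / a)"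
      by (rule integral_FTC_atLeastAtMost)
         (use a0 in \<open>auto intro!: continuous_intros derivative_eq_intros exp_vector_derivative\<close>)
    then show ?thesis by simp
  qed
  moreover have "(\<lambda>n. 1 / a - exp (- (a * of_real n)) / a) \<longlonglongrightarrow> 1 / a - 0 / a"
  proof (intro tendsto_intros a0)
    show "(\<lambda>n. exp (- (a * of_real n))) \<longlonglongrightarrow> (0::complex)"
      by (rule tendsto_norm_zero_cancel)
         (use filterlim_compose[OF exp_decay[OF a] filterlim_real_sequentially] in simp)
  qed
  ultimately show ?thesis using LIMSEQ_unique by fastforce
qed

lemma half_exp_mult_cnj: "half_exp a x * cnj (half_exp b x) = half_exp (a + cnj b) x"
  by (simp add: half_exp_def exp_cnj flip: exp_add) (simp add: algebra_simps)

lemma square_integrable_half_exp: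
  assumes "Re a > 0"
  shows "square_integrable (half_exp a)"
proof -
  have "(cmod (half_exp a x))\<^sup>2 = cmod (half_exp (a + cnj a) x)" for x
    unfolding half_exp_mult_cnj[symmetric] by (simp add: norm_mult power2_eq_square)
  moreover have "integrable lborel (\<lambda>x. cmod (half_exp (a + cnj a) x))"
    using assms by (intro integrable_norm integrable_half_exp) simp
  ultimately show ?thesis by (simp add: square_integrable_def)
qed

lemma square_integrable_reflect:
  assumes "square_integrable f"
  shows "square_integrable (\<lambda>x. f (- x))"
proof -
  have [measurable]: "f \<in> borel_measurable borel" using assms by (simp add: square_integrable_def)
  have "integrable lborel (\<lambda>x. (cmod (f (0 + (-1) * x)))\<^sup>2)"
    using assms lborel_integrable_real_affine_iff[of "-1" "\<lambda>x. (cmod (f x))\<^sup>2" 0]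
    by (simp add: square_integrable_def)
  then show ?thesis by (simp add: square_integrable_def)
qed

lemma integral_reflect: "(LINT x|lborel. f (- x)) = (LINT x|lborel. f (x::real))" for f :: "real \<Rightarrow> complex"
  using lborel_integral_real_affine[of "-1" f 0] by simp

section \<open>Exponentials on the two half-lines and the explicit resolvent of the
  Laplacian\<close>

definition right_exp :: "complex \<Rightarrow> L2" where
  "right_exp a = abs_L2 (half_exp a)"

definition left_exp :: "complex \<Rightarrow> L2" where
  "left_exp a = abs_L2 (\<lambda>x. half_exp a (- x))"

lemma cinner_right_right:
  assumes "Re a > 0" "Re b > 0"
  shows "cinner (right_exp a) (right_exp b) = 1 / (a + cnj b)"
  using assms
  by (simp add: right_exp_def cinner_abs_abs square_integrable_half_exp half_exp_mult_cnj integral_half_exp)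

lemma cinner_left_right:
  assumes "Re a > 0" "Re b > 0"
  shows "cinner (left_exp a) (right_exp b) = 0"
proof -
  have "cinner (left_exp a) (right_exp b) = (LINT x|lborel. half_exp a (- x) * cnj (half_exp b x))"
    using assms
    by (simp add: left_exp_def right_exp_def cinner_abs_abs square_integrable_half_exp square_integrable_reflect)
  also have "(\<lambda>x. half_exp a (- x) * cnj (half_exp b x)) = (\<lambda>x. 0)"
    by (auto simp: half_exp_def)
  finally show ?thesis by simp
qed

text \<open>The integrand is the derivative of the exponential times \<open>h\<close> on
  \<open>{0..M}\<close>. The value at \<open>M\<close> is zero, so only the jump at 0
  remains.\<close>

lemma half_exp_by_parts:
  assumes h: "\<And>x. (h has_real_derivative h' x) (at x)" and h': "continuous_on UNIV h'"
    and M: "M > 0" "\<And>x. M \<le> x \<Longrightarrow> h x = 0" "\<And>x. M \<le> x \<Longrightarrow> h' x = 0"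
  shows "(LINT x|lborel. half_exp a x * of_real (h' x) - a * (half_exp a x * of_real (h x))) = - of_real (h 0)"
proof -
  let ?F = "\<lambda>x. exp (- (a * of_real x)) * of_real (h x) :: complex"
  let ?f = "\<lambda>x. exp (- (a * of_real x)) * of_real (h' x) - a * exp (- (a * of_real x)) * of_real (h x) :: complex"
  have ch: "continuous_on S h" for S
    by (meson h DERIV_continuous_on has_field_derivative_at_within)
  have ch': "continuous_on S h'" for S using h' by (rule continuous_on_subset) simp
  have [measurable]: "h \<in> borel_measurable borel" "h' \<in> borel_measurable borel"
    by (intro borel_measurable_continuous_onI ch ch')+
  have [measurable]: "(\<lambda>x::real. exp (- (a * of_real x))) \<in> borel_measurable borel"
    by (intro borel_measurable_continuous_onI continuous_intros)
  have "(LINT x|lborel. half_exp a x * of_real (h' x) - a * (half_exp a x * of_real (h x)))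
      = (LINT x|lborel. indicator {0..M} x *\<^sub>R ?f x)"
  proof (rule integral_cong_AE)
    have "half_exp a x * of_real (h' x) - a * (half_exp a x * of_real (h x)) = indicator {0..M} x *\<^sub>R ?f x"
      if "x \<noteq> 0" for x
      using that M by (auto simp: half_exp_def split: split_indicator)
    then show "AE x in lborel. half_exp a x * of_real (h' x) - a * (half_exp a x * of_real (h x))
        = indicator {0..M} x *\<^sub>R ?f x"
      using AE_lborel_singleton[of 0] by (auto elim!: eventually_mono)
  qed measurable
  also have "\<dots> = ?F M - ?F 0"
  proof (rule integral_FTC_atLeastAtMost)
    show "continuous_on {0..M} ?f" by (intro continuous_intros ch ch')
    fix x
    have "((\<lambda>x. of_real (h x)) has_vector_derivative (of_real (h' x) :: complex)) (at x within {0..M})"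
      using h has_field_derivative_at_within has_real_derivative_iff_has_vector_derivative
      by (intro has_vector_derivative_of_real) blast
    from has_vector_derivative_mult[OF exp_vector_derivative[of a x] this]
    show "(?F has_vector_derivative ?f x) (at x within {0..M})" by simp
  qed (use M in simp)
  finally show ?thesis using M(2)[of M] by simp
qed

text \<open>In the sense of distributions, the derivative of \<open>right_exp a\<close> is
  \<open>- a\<close> times itself plus a point mass at 0, and that of \<open>left_exp a\<close> is
  \<open>a\<close> times itself minus that mass.\<close>

lemma test_fun_by_parts:
  assumes \<eta>: "test_fun \<eta>" and a: "Re a > 0"
  shows "cinner (right_exp a) (test_vec (deriv \<eta>)) = a * cinner (right_exp a) (test_vec \<eta>) - of_real (\<eta> 0)"
    and "cinner (left_exp a) (test_vec (deriv \<eta>)) = of_real (\<eta> 0) - a * cinner (left_exp a) (test_vec \<eta>)"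
proof -
  obtain M1 M2 where "M1 > 0" and M1: "\<And>x. M1 \<le> \<bar>x\<bar> \<Longrightarrow> \<eta> x = 0" and M2: "\<And>x. M2 \<le> \<bar>x\<bar> \<Longrightarrow> deriv \<eta> x = 0"
    using test_fun_support[OF \<eta>] test_fun_support[OF test_fun_deriv[OF \<eta>]] by metis
  define M where "M = max M1 M2"
  have M: "M > 0" "\<And>x. M \<le> \<bar>x\<bar> \<Longrightarrow> \<eta> x = 0" "\<And>x. M \<le> \<bar>x\<bar> \<Longrightarrow> deriv \<eta> x = 0"
    using \<open>M1 > 0\<close> M1 M2 by (auto simp: M_def)
  have \<eta>': "test_fun (deriv \<eta>)" by (rule test_fun_deriv[OF \<eta>])
  have sq: "square_integrable (half_exp a)" "square_integrable (\<lambda>x. half_exp a (- x))"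
    "square_integrable (\<lambda>x. of_real (\<eta> x))" "square_integrable (\<lambda>x. of_real (deriv \<eta> x))"
    by (intro square_integrable_half_exp a square_integrable_reflect square_integrable_test_fun \<eta> \<eta>')+
  have R: "cinner (right_exp a) (test_vec \<zeta>) = (LINT x|lborel. half_exp a x * of_real (\<zeta> x))"
      "integrable lborel (\<lambda>x. half_exp a x * of_real (\<zeta> x))"
    if "test_fun \<zeta>" for \<zeta>
    using cinner_abs_abs[OF sq(1) square_integrable_test_fun[OF that]]
      integrable_mult_cnj[OF sq(1) square_integrable_test_fun[OF that]]
    by (simp_all add: right_exp_def test_vec_def)
  have L: "cinner (left_exp a) (test_vec \<zeta>) = (LINT x|lborel. half_exp a x * of_real (\<zeta> (- x)))"
      "integrable lborel (\<lambda>x. half_exp a x * of_real (\<zeta> (- x)))"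
    if "test_fun \<zeta>" for \<zeta>
    using cinner_abs_abs[OF sq(2) square_integrable_test_fun[OF that]]
      integrable_mult_cnj[OF sq(1) square_integrable_reflect[OF square_integrable_test_fun[OF that]]]
      integral_reflect[of "\<lambda>x. half_exp a x * of_real (\<zeta> (- x))"]
    by (simp_all add: left_exp_def test_vec_def)
  have int: "(LINT x|lborel. f x - a * g x) = (LINT x|lborel. f x) - a * (LINT x|lborel. g x)"
    if "integrable lborel f" "integrable lborel g" for f g :: "real \<Rightarrow> complex"
    using that by simp
  have "(LINT x|lborel. half_exp a x * of_real (deriv \<eta> x) - a * (half_exp a x * of_real (\<eta> x))) = - of_real (\<eta> 0)"
    by (rule half_exp_by_parts[OF test_fun_DERIV[OF \<eta>] continuous_on_test_fun[OF \<eta>'] M(1)]) (use M in auto)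
  then show "cinner (right_exp a) (test_vec (deriv \<eta>)) = a * cinner (right_exp a) (test_vec \<eta>) - of_real (\<eta> 0)"
    unfolding int[OF R(2)[OF \<eta>'] R(2)[OF \<eta>]] R(1)[OF \<eta>, symmetric] R(1)[OF \<eta>', symmetric]
    by (simp add: diff_eq_eq)
  \<comment> \<open>The left half-line reduces to the right one by reflecting the test
    function.\<close>
  have "((\<lambda>x. \<eta> (- x)) has_real_derivative - deriv \<eta> (- x)) (at x)" for x
    using DERIV_chain2[OF test_fun_DERIV[OF \<eta>, of "- x"] DERIV_minus[OF DERIV_ident]] by simp
  moreover have "continuous_on UNIV (\<lambda>x. - deriv \<eta> (- x))"
    by (intro continuous_intros continuous_on_compose2[OF continuous_on_test_fun[OF \<eta>', of UNIV]]) auto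
  ultimately have "(LINT x|lborel. half_exp a x * of_real (- deriv \<eta> (- x)) - a * (half_exp a x * of_real (\<eta> (- x))))
      = - of_real (\<eta> (- 0))"
    by (rule half_exp_by_parts[OF _ _ M(1)]) (use M in auto)
  then have "(LINT x|lborel. - (half_exp a x * of_real (deriv \<eta> (- x))) - a * (half_exp a x * of_real (\<eta> (- x))))
      = - of_real (\<eta> 0)"
    by simp
  then have "- cinner (left_exp a) (test_vec (deriv \<eta>)) - a * cinner (left_exp a) (test_vec \<eta>) = - of_real (\<eta> 0)"
    unfolding int[OF Bochner_Integration.integrable_minus[OF L(2)[OF \<eta>']] L(2)[OF \<eta>]]
      L(1)[OF \<eta>] L(1)[OF \<eta>'] by simp
  then show "cinner (left_exp a) (test_vec (deriv \<eta>)) = of_real (\<eta> 0) - a * cinner (left_exp a) (test_vec \<eta>)"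
    by (simp add: algebra_simps)
qed

text \<open>The jumps at \<open>0\<close> cancel under the hypothesis on \<open>p\<close>, \<open>q\<close>, \<open>r\<close>.\<close>

lemma weak_deriv_exponentials:
  assumes "Re a > 0" "Re b > 0" "Re k > 0" and "p = q + r"
  shows "has_weak_deriv (cscale p (left_exp a) + (cscale q (right_exp b) + cscale r (right_exp k)))
    (cscale (a * p) (left_exp a) + (cscale (- b * q) (right_exp b) + cscale (- k * r) (right_exp k)))"
  using assms
  by (auto simp: has_weak_deriv_iff cinner_add_left cinner_cscale_left test_fun_by_parts algebra_simps)

text \<open>The inhomogeneous equation \<open>k\<^sup>2 v - v'' = e\<^bsup>-x\<^esup> 1\<^bsub>x>0\<^esub>\<close>, solved by matching \<open>v\<close> and \<open>v'\<close> at \<open>0\<close>.\<close>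

lemma Laplacian_resolvent_right_exp:
  fixes k :: complex
  assumes k: "Re k > 0" "k\<^sup>2 \<noteq> 1"
  obtains v where "(v, right_exp 1 - cscale (k\<^sup>2) v) \<in> Laplacian"
    and "cinner (right_exp 1 - cscale (k\<^sup>2) v) (right_exp 1) = 1 / (2 * (1 + k))"
proof -
  have "k \<noteq> - 1" "k \<noteq> 1" using k by auto
  then have nz: "k \<noteq> 0" "k + 1 \<noteq> 0" "k - 1 \<noteq> 0"
    using k by (auto simp: add_eq_0_iff2)
  define i where "i = 1 / (2 * k * (k - 1) * (k + 1))"
  have i: "2 * k * (k - 1) * (k + 1) * i = 1" using nz by (simp add: i_def)
  \<comment> \<open>\<open>C = 1 / (k\<^sup>2 - 1)\<close> belongs to the particular solution on the
    right half-line; \<open>A\<close> and \<open>B\<close> weight the homogeneous solutions on the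
    left and right and solve the matching conditions \<open>AB\<close> and
    \<open>AB'\<close>.\<close>
  define A B C where "A = (k - 1) * i" and "B = - (k + 1) * i" and "C = 2 * k * i"
  have AB: "A = C + B" and AB': "k * A = - 1 * C + - k * B"
    unfolding A_def B_def C_def by (simp_all add: algebra_simps)
  have "k\<^sup>2 * C - C = 2 * k * (k - 1) * (k + 1) * i"
    unfolding C_def by (simp add: algebra_simps power2_eq_square)
  then have C: "k\<^sup>2 * C = C + 1" unfolding i by (simp add: algebra_simps)
  define v where "v = cscale A (left_exp k) + (cscale C (right_exp 1) + cscale B (right_exp k))"
  define v' where "v' = cscale (k * A) (left_exp k) + (cscale (- 1 * C) (right_exp 1) + cscale (- k * B) (right_exp k))"
  have 1: "has_weak_deriv v v'"
    unfolding v_def v'_def by (rule weak_deriv_exponentials) (use k AB in auto)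
  have "has_weak_deriv v' (cscale (k * (k * A)) (left_exp k) +
      (cscale (- 1 * (- 1 * C)) (right_exp 1) + cscale (- k * (- k * B)) (right_exp k)))"
    unfolding v'_def by (rule weak_deriv_exponentials) (use k AB' in auto)
  also have "cscale (k * (k * A)) (left_exp k) +
      (cscale (- 1 * (- 1 * C)) (right_exp 1) + cscale (- k * (- k * B)) (right_exp k))
    = - (right_exp 1 - cscale (k\<^sup>2) v)"
  proof (rule L2_eqI)
    fix y
    have "k\<^sup>2 * (C * cinner (right_exp 1) y) = (C + 1) * cinner (right_exp 1) y"
      using C by (simp flip: mult.assoc)
    then show "cinner (cscale (k * (k * A)) (left_exp k) +
      (cscale (- 1 * (- 1 * C)) (right_exp 1) + cscale (- k * (- k * B)) (right_exp k))) y
      = cinner (- (right_exp 1 - cscale (k\<^sup>2) v)) y"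
      by (simp add: v_def cinner_minus_left cinner_diff_left cinner_add_left cinner_cscale_left distrib_left distrib_right)
         (simp add: power2_eq_square algebra_simps)
  qed
  finally have "(v, right_exp 1 - cscale (k\<^sup>2) v) \<in> Laplacian"
    using 1 unfolding Laplacian_def by blast
  moreover have "cinner (right_exp 1 - cscale (k\<^sup>2) v) (right_exp 1) = 1 / (2 * (1 + k))"
  proof -
    \<comment> \<open>The left part of \<open>v\<close> is orthogonal to \<open>right_exp 1\<close>;
      the right parts have the products 1/2 and \<open>1 / (k + 1)\<close> with it.\<close>
    have "cinner (right_exp 1 - cscale (k\<^sup>2) v) (right_exp 1) = 1 / 2 - k\<^sup>2 * (C / 2 + B / (k + 1))"
      using k by (simp add: v_def cinner_diff_left cinner_add_left cinner_cscale_left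
          cinner_left_right cinner_right_right)
    also have "C / 2 + B / (k + 1) = (k - 1) * i"
    proof -
      have "B = (k + 1) * (- i)" by (simp only: B_def mult_minus_left mult_minus_right)
      then have "B / (k + 1) = - i" by (simp only: nonzero_mult_div_cancel_left[OF nz(2)])
      then show ?thesis by (simp add: C_def algebra_simps)
    qed
    also have "k\<^sup>2 * ((k - 1) * i) = k / (2 * (k + 1))"
      using nz by (simp add: i_def power2_eq_square)
    also have "1 / 2 - k / (2 * (k + 1)) = 1 / (2 * (1 + k))"
    proof -
      have "1 / 2 = (k + 1) / (2 * (k + 1))"
        by (rule nonzero_divide_mult_cancel_right[OF nz(2), symmetric])
      then show ?thesis by (simp only: diff_divide_distrib[symmetric]) (simp add: add.commute)
    qed
    finally show ?thesis .
  qed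
  ultimately show thesis by (rule that)
qed

section \<open>The viscosity operator\<close>

lemma square_integrable_bounded_mult:
  fixes a :: "real \<Rightarrow> real"
  assumes a: "a \<in> borel_measurable borel" "\<And>x. \<bar>a x\<bar> \<le> B" and f: "square_integrable f"
  shows "square_integrable (\<lambda>x. of_real (a x) * f x)"
proof -
  have [measurable]: "a \<in> borel_measurable borel" "f \<in> borel_measurable borel"
    using a f by (auto simp: square_integrable_def)
  have i: "integrable lborel (\<lambda>x. B\<^sup>2 * (cmod (f x))\<^sup>2)"
    using f by (simp add: square_integrable_def)
  have "(cmod (of_real (a x) * f x))\<^sup>2 \<le> B\<^sup>2 * (cmod (f x))\<^sup>2" for x
    using power_mono[OF a(2)[of x], of 2] by (auto simp: norm_mult power_mult_distrib intro!: mult_right_mono)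
  then have "integrable lborel (\<lambda>x. (cmod (of_real (a x) * f x))\<^sup>2)"
    by (intro Bochner_Integration.integrable_bound[OF i]) auto
  then show ?thesis by (simp add: square_integrable_def)
qed

lemma integrable_energy:
  fixes a :: "real \<Rightarrow> real"
  assumes "a \<in> borel_measurable borel" "\<And>x. \<bar>a x\<bar> \<le> B"
  shows "integrable lborel (\<lambda>x. of_real (a x) * rep_L2 p x * cnj (rep_L2 q x))"
  by (intro integrable_mult_cnj square_integrable_bounded_mult[OF assms] square_integrable_rep)

text \<open>With \<open>v = s r\<close>, the estimate is \<open>h(v - u) \<ge> 0\<close> combined with \<open>h(v, \<cdot>) = s (u - v, \<cdot>)\<close>.\<close>

lemma form_resolvent_estimate:
  fixes a :: "real \<Rightarrow> real"
  assumes a: "a \<in> borel_measurable borel" "\<And>x. \<bar>a x\<bar> \<le> B" "\<And>x. 0 \<le> a x"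
    and r: "(r, u - s *\<^sub>R r) \<in> form_oper W12 (energy_form a)" and u: "u \<in> W12"
  shows "s * inner (u - s *\<^sub>R r) u + s * (norm (u - s *\<^sub>R r))\<^sup>2 \<le> Re (energy_form a u u)"
proof -
  let ?p = "rep_L2 (weak_deriv r)" and ?q = "rep_L2 (weak_deriv u)"
  let ?A = "\<lambda>x. of_real (a x) * ?p x * cnj (?p x)" and ?B = "\<lambda>x. of_real (a x) * ?p x * cnj (?q x)"
    and ?C = "\<lambda>x. of_real (a x) * ?q x * cnj (?q x)"
  have h: "energy_form a r u = cinner (u - s *\<^sub>R r) u" "energy_form a r r = cinner (u - s *\<^sub>R r) r"
    using r u by (auto simp: form_oper_def)
  have i: "integrable lborel ?A" "integrable lborel ?B" "integrable lborel ?C"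
    by (intro integrable_energy[OF a(1,2)])+
  \<comment> \<open>The integrand of the form at \<open>s *\<^sub>R r - u\<close>. Its cross terms
    are conjugate, so one of them with coefficient \<open>2 * s\<close> suffices under
    \<open>Re\<close>.\<close>
  have sq: "a x * (cmod (of_real s * ?p x - ?q x))\<^sup>2
      = Re (of_real (s\<^sup>2) * ?A x - of_real (2 * s) * ?B x + ?C x)" for x
    unfolding cmod_power2 by (simp add: power2_eq_square algebra_simps)
  have "0 \<le> (LINT x|lborel. Re (of_real (s\<^sup>2) * ?A x - of_real (2 * s) * ?B x + ?C x))"
    unfolding sq[symmetric]
    by (intro Bochner_Integration.integral_nonneg mult_nonneg_nonneg a(3) zero_le_power2)
  also have "\<dots> = Re (LINT x|lborel. of_real (s\<^sup>2) * ?A x - of_real (2 * s) * ?B x + ?C x)"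
    using i by (intro integral_Re) (auto simp del: of_real_mult of_real_power)
  also have "(LINT x|lborel. of_real (s\<^sup>2) * ?A x - of_real (2 * s) * ?B x + ?C x)
      = of_real (s\<^sup>2) * (LINT x|lborel. ?A x) - of_real (2 * s) * (LINT x|lborel. ?B x) + (LINT x|lborel. ?C x)"
    using i by (simp del: of_real_mult of_real_power)
  also have "Re \<dots> = s\<^sup>2 * Re (energy_form a r r) - 2 * s * Re (energy_form a r u) + Re (energy_form a u u)"
    unfolding energy_form_def by (simp del: of_real_mult of_real_power add: Re_complex_of_real)
  also have "\<dots> = s * inner (u - s *\<^sub>R r) (s *\<^sub>R r) - 2 * (s * inner (u - s *\<^sub>R r) u) + Re (energy_form a u u)"
    unfolding h inner_L2_def by (simp add: cinner_scaleR_right power2_eq_square)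
  also have "inner (u - s *\<^sub>R r) (s *\<^sub>R r) = inner (u - s *\<^sub>R r) u - (norm (u - s *\<^sub>R r))\<^sup>2"
    unfolding power2_norm_eq_inner by (simp flip: inner_diff_right)
  finally show ?thesis by (simp add: right_diff_distrib)
qed

text \<open>Take \<open>v = s *\<^sub>R S u\<close>. The estimate for the approximating forms
  survives the strong resolvent limit, since it is continuous in the resolvent. As
  \<open>inner h v\<close> equals \<open>s * inner (u - v) u - s * (norm (u - v))\<^sup>2\<close>
  and is nonnegative, both conclusions follow.\<close>

lemma viscosity_approximation:
  fixes c :: "real \<Rightarrow> real"
  assumes c: "c \<in> borel_measurable borel" "\<And>x. 0 \<le> c x" "\<And>x. c x \<le> B"
    and H: "is_viscosity_oper c H"
    and q: "has_weak_deriv u q" and K: "Re (LINT x|lborel. of_real (c x) * rep_L2 q x * cnj (rep_L2 q x)) \<le> K"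
    and s: "s > 0"
  obtains v h where "(v, h) \<in> H" "inner h v \<le> K" "s * (norm (u - v))\<^sup>2 \<le> K"
proof -
  let ?A = "\<lambda>\<epsilon>. form_oper W12 (energy_form (\<lambda>x. c x + \<epsilon>))"
  obtain R S where R: "\<And>\<epsilon>. \<epsilon> \<in> {0<..1} \<Longrightarrow> is_resolvent (?A \<epsilon>) s (R \<epsilon>)" and S: "is_resolvent H s S"
    and lim: "((\<lambda>\<epsilon>. R \<epsilon> u) \<longlongrightarrow> S u) (at_right 0)"
    using H s unfolding is_viscosity_oper_def strong_resolvent_limit_def by meson
  have u: "u \<in> W12" using q by (auto simp: W12_def)
  let ?g = "\<lambda>r. s * inner (u - s *\<^sub>R r) u + s * (norm (u - s *\<^sub>R r))\<^sup>2"
  have bound: "?g (R \<epsilon> u) \<le> K + \<epsilon> * (norm q)\<^sup>2" if \<epsilon>: "\<epsilon> \<in> {0<..1}" for \<epsilon>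
  proof -
    have "(R \<epsilon> u, u - s *\<^sub>R R \<epsilon> u) \<in> ?A \<epsilon>"
      using R[OF \<epsilon>] unfolding is_resolvent_def by blast
    then have "?g (R \<epsilon> u) \<le> Re (energy_form (\<lambda>x. c x + \<epsilon>) u u)"
      by (rule form_resolvent_estimate[rotated 3, where B = "B + 1"])
         (use u c \<epsilon> in \<open>auto simp: abs_of_nonneg add_nonneg_nonneg intro: add_mono\<close>)
    also have "energy_form (\<lambda>x. c x + \<epsilon>) u u
        = (LINT x|lborel. of_real (c x) * rep_L2 q x * cnj (rep_L2 q x) + of_real \<epsilon> * (rep_L2 q x * cnj (rep_L2 q x)))"
      unfolding energy_form_def weak_deriv_eq[OF q] by (simp add: algebra_simps)
    also have "\<dots> = (LINT x|lborel. of_real (c x) * rep_L2 q x * cnj (rep_L2 q x)) + of_real \<epsilon> * cinner q q"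
      using integrable_energy[of c B q q] c integrable_mult_cnj[OF square_integrable_rep square_integrable_rep, of q q]
        cinner_abs_abs[OF square_integrable_rep square_integrable_rep, of q q]
      by simp
    also have "Re \<dots> \<le> K + \<epsilon> * (norm q)\<^sup>2"
      using K by (simp add: cinner_same)
    finally show ?thesis .
  qed
  have "?g (S u) \<le> K + 0 * (norm q)\<^sup>2"
  proof (rule tendsto_le)
    show "((\<lambda>\<epsilon>. K + \<epsilon> * (norm q)\<^sup>2) \<longlongrightarrow> K + 0 * (norm q)\<^sup>2) (at_right 0)"
      by (intro tendsto_intros)
    show "((\<lambda>\<epsilon>. ?g (R \<epsilon> u)) \<longlongrightarrow> ?g (S u)) (at_right 0)" by (intro tendsto_intros lim)
    have "\<forall>\<^sub>F \<epsilon> in at_right (0::real). \<epsilon> \<in> {0<..1}"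
      using eventually_at_right_less[of "0::real"] eventually_at_right_field[of "\<lambda>\<epsilon>. \<epsilon> \<le> 1" 0]
      by (auto elim!: eventually_elim2 intro: exI[of _ 1])
    then show "\<forall>\<^sub>F \<epsilon> in at_right 0. ?g (R \<epsilon> u) \<le> K + \<epsilon> * (norm q)\<^sup>2"
      by eventually_elim (rule bound)
  qed simp
  then have g: "?g (S u) \<le> K" by simp
  let ?v = "s *\<^sub>R S u"
  have "(S u, u - ?v) \<in> H" using S unfolding is_resolvent_def by blast
  then have vH: "(?v, s *\<^sub>R (u - ?v)) \<in> H"
    using H unfolding is_viscosity_oper_def positive_self_adjoint_def linear_oper_def scaleR_L2_def by blast
  then have "0 \<le> Re (cinner (s *\<^sub>R (u - ?v)) ?v)"
    using H unfolding is_viscosity_oper_def positive_self_adjoint_def by blast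
  then have pos: "0 \<le> inner (s *\<^sub>R (u - ?v)) ?v" by (simp only: inner_L2_def)
  have eq: "inner (s *\<^sub>R (u - ?v)) ?v = s * inner (u - ?v) u - s * (norm (u - ?v))\<^sup>2"
    unfolding power2_norm_eq_inner by (simp add: inner_diff_right right_diff_distrib)
  have n: "0 \<le> s * (norm (u - ?v))\<^sup>2" using s by simp
  show thesis
  proof (rule that[OF vH])
    show "inner (s *\<^sub>R (u - ?v)) ?v \<le> K" using eq g n by linarith
    show "s * (norm (u - ?v))\<^sup>2 \<le> K" using eq pos g n by linarith
  qed
qed

section \<open>Energy bounds uniform in the steepness, and failure of subellipticity\<close>

lemma integral_norm_half_exp:
  assumes "m > 0"
  shows "(LINT x|lborel. cmod (half_exp (of_real m) x)) = 1 / m"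
proof -
  have "of_real (cmod (half_exp (of_real m) x)) = half_exp (of_real m) x" for x
    by (simp add: half_exp_def exp_of_real flip: of_real_mult of_real_minus)
  then have "(LINT x|lborel. complex_of_real (cmod (half_exp (of_real m) x))) = 1 / of_real m"
    using assms by (simp add: integral_half_exp)
  then have "complex_of_real (LINT x|lborel. cmod (half_exp (of_real m) x)) = 1 / of_real m"
    by (simp only: integral_complex_of_real)
  then show ?thesis by (metis of_real_1 of_real_divide of_real_eq_iff)
qed

text \<open>The inequality \<open>m * x \<le> exp (m * x)\<close> absorbs the weight. What remains
  has integral 1 for every \<open>m\<close>, so the energy does not grow with the steepness.\<close>

lemma half_exp_energy_le:
  assumes "m > 0"
  shows "\<bar>x\<bar> * (m * cmod (half_exp (of_real m) x))\<^sup>2 \<le> m * cmod (half_exp (of_real m) x)"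
proof (cases "x > 0")
  case True
  let ?e = "exp (- (m * x))"
  have "m * x \<le> exp (m * x)" using exp_ge_add_one_self[of "m * x"] by linarith
  then have "m * x * ?e \<le> exp (m * x) * ?e" by (intro mult_right_mono) auto
  also have "\<dots> = 1" by (simp flip: exp_add)
  finally have "(m * x * ?e) * (m * ?e) \<le> 1 * (m * ?e)" using assms by (intro mult_right_mono) auto
  then show ?thesis using True by (simp add: norm_half_exp power2_eq_square mult_ac)
qed (simp add: half_exp_def)

text \<open>The jumps at 0 cancel, so the derivative \<open>q\<close> is a combination of the two
  exponentials. The square of a sum is at most twice the sum of squares, and each square has
  weighted integral at most 1; hence the constant 4.\<close>

lemma right_exp_difference_energy:
  assumes m: "m > 0" and c: "c \<in> borel_measurable borel" "\<And>x. 0 \<le> c x" "\<And>x. c x \<le> B" "\<And>x. c x \<le> \<bar>x\<bar>"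
  obtains q where "has_weak_deriv (right_exp 1 - right_exp (of_real m)) q"
    and "Re (LINT x|lborel. of_real (c x) * rep_L2 q x * cnj (rep_L2 q x)) \<le> 4"
proof -
  let ?e1 = "half_exp 1" and ?em = "half_exp (of_real m)"
  define q where "q = cscale (-1) (right_exp 1) + cscale (of_real m) (right_exp (of_real m))"
  have "has_weak_deriv (cscale 0 (left_exp 1) + (cscale 1 (right_exp 1) + cscale (-1) (right_exp (of_real m))))
    (cscale (1 * 0) (left_exp 1) + (cscale (-1 * 1) (right_exp 1) + cscale (- of_real m * -1) (right_exp (of_real m))))"
    by (rule weak_deriv_exponentials) (use m in auto)
  also have "cscale 0 (left_exp 1) + (cscale 1 (right_exp 1) + cscale (-1) (right_exp (of_real m)))
      = right_exp 1 - right_exp (of_real m)"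
    by (rule L2_eqI) (simp add: cinner_simps)
  also have "cscale (1 * 0) (left_exp 1) + (cscale (-1 * 1) (right_exp 1) + cscale (- of_real m * -1) (right_exp (of_real m))) = q"
    unfolding q_def by (rule L2_eqI) (simp add: cinner_simps)
  finally have 1: "has_weak_deriv (right_exp 1 - right_exp (of_real m)) q" .
  have rep: "AE x in lborel. rep_L2 q x = - ?e1 x + of_real m * ?em x"
    using rep_L2_plus[of "cscale (-1) (right_exp 1)" "cscale (of_real m) (right_exp (of_real m))"]
      rep_L2_cscale[of "-1" "right_exp 1"] rep_L2_cscale[of "of_real m" "right_exp (of_real m)"]
      rep_abs_L2[OF square_integrable_half_exp, of 1] rep_abs_L2[OF square_integrable_half_exp, of "of_real m"] m
    unfolding q_def right_exp_def by (auto elim: AE_mp)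
  have i: "integrable lborel (\<lambda>x. 2 * cmod (?e1 x) + 2 * (m * cmod (?em x)))"
    using m by (intro Bochner_Integration.integrable_add integrable_mult_right integrable_norm integrable_half_exp) auto
  have "AE x in lborel. Re (of_real (c x) * rep_L2 q x * cnj (rep_L2 q x)) \<le> 2 * cmod (?e1 x) + 2 * (m * cmod (?em x))"
    using rep
  proof eventually_elim
    case (elim x)
    have "Re (of_real (c x) * rep_L2 q x * cnj (rep_L2 q x)) = c x * (cmod (rep_L2 q x))\<^sup>2"
      unfolding cmod_power2 by (simp add: power2_eq_square algebra_simps)
    also have "\<dots> \<le> \<bar>x\<bar> * (cmod (- ?e1 x + of_real m * ?em x))\<^sup>2"
      unfolding elim using c by (intro mult_right_mono) auto
    also have "\<dots> \<le> \<bar>x\<bar> * (2 * (1 * cmod (?e1 x))\<^sup>2 + 2 * (m * cmod (?em x))\<^sup>2)"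
    proof (rule mult_left_mono)
      have "cmod (- ?e1 x + of_real m * ?em x) \<le> cmod (?e1 x) + m * cmod (?em x)"
        using norm_triangle_ineq[of "- ?e1 x" "of_real m * ?em x"] m by (simp add: norm_mult)
      then have "(cmod (- ?e1 x + of_real m * ?em x))\<^sup>2 \<le> (cmod (?e1 x) + m * cmod (?em x))\<^sup>2"
        by (rule power_mono) simp
      also have "\<dots> \<le> 2 * (1 * cmod (?e1 x))\<^sup>2 + 2 * (m * cmod (?em x))\<^sup>2"
        using sum_squares_bound[of "cmod (?e1 x)" "m * cmod (?em x)"] unfolding power2_sum by simp
      finally show "(cmod (- ?e1 x + of_real m * ?em x))\<^sup>2 \<le> 2 * (1 * cmod (?e1 x))\<^sup>2 + 2 * (m * cmod (?em x))\<^sup>2" .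
    qed simp
    also have "\<dots> = 2 * (\<bar>x\<bar> * (1 * cmod (?e1 x))\<^sup>2) + 2 * (\<bar>x\<bar> * (m * cmod (?em x))\<^sup>2)"
      by (simp add: distrib_left)
    also have "\<dots> \<le> 2 * cmod (?e1 x) + 2 * (m * cmod (?em x))"
      using half_exp_energy_le[of 1 x] half_exp_energy_le[OF m, of x] by simp
    finally show ?case .
  qed
  then have "(LINT x|lborel. Re (of_real (c x) * rep_L2 q x * cnj (rep_L2 q x)))
      \<le> (LINT x|lborel. 2 * cmod (?e1 x) + 2 * (m * cmod (?em x)))"
    using i integrable_energy[of c B q q] c by (intro integral_mono_AE integrable_Re) auto
  also have "\<dots> = 2 * (LINT x|lborel. cmod (?e1 x)) + 2 * (m * (LINT x|lborel. cmod (?em x)))"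
    using m by (subst Bochner_Integration.integral_add)
      (auto intro!: integrable_mult_right integrable_norm integrable_half_exp)
  also have "\<dots> = 4"
    using integral_norm_half_exp[of 1] integral_norm_half_exp[OF m] m by simp
  finally have "Re (LINT x|lborel. of_real (c x) * rep_L2 q x * cnj (rep_L2 q x)) \<le> 4"
    using integrable_energy[of c B q q] c by (subst integral_Re[symmetric]) auto
  with 1 show thesis by (rule that)
qed

lemma norm_right_exp: "m > 0 \<Longrightarrow> (norm (right_exp (of_real m)))\<^sup>2 = 1 / (2 * m)"
proof -
  assume "m > 0"
  then have "complex_of_real ((norm (right_exp (of_real m)))\<^sup>2) = of_real (1 / (2 * m))"
    unfolding cinner_same[symmetric] by (simp add: cinner_right_right)
  then show ?thesis using of_real_eq_iff by blast
qed

lemma not_subelliptic: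
  fixes c :: "real \<Rightarrow> real"
  assumes c: "c \<in> borel_measurable borel" "\<And>x. 0 \<le> c x" "\<And>x. c x \<le> B" "\<And>x. c x \<le> \<bar>x\<bar>"
    and H: "is_viscosity_oper c H"
  shows "\<not> subelliptic (1/2) H"
proof
  assume "subelliptic (1/2) H"
  then obtain S T \<mu> \<nu> where S: "is_oper_power H (1/2) S" and T: "is_oper_power Laplacian (1/4) T"
    and dom: "Domain S \<subseteq> Domain T" and \<mu>: "\<mu> > 0" "\<nu> \<ge> 0"
    and sub: "\<And>u f g. (u, f) \<in> S \<Longrightarrow> (u, g) \<in> T \<Longrightarrow> (norm f)\<^sup>2 + \<nu> * (norm u)\<^sup>2 \<ge> \<mu> * (norm g)\<^sup>2"
    unfolding subelliptic_def by auto
  obtain E where E: "projection_valued_measure E" "is_spectral_integral E (\<lambda>t. t) H"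
    "is_spectral_integral E (\<lambda>t. t powr (1/2)) S"
    using S unfolding is_oper_power_def by blast
  obtain G where G: "projection_valued_measure G" "is_spectral_integral G (\<lambda>t. t) Laplacian"
    "is_spectral_integral G (\<lambda>t. t powr (1/4)) T"
    using T unfolding is_oper_power_def by blast
  interpret E: pvm E by unfold_locales (rule E)
  interpret G: pvm G by unfold_locales (rule G)
  define w where "w = right_exp 1"
  \<comment> \<open>Choosing \<open>s\<close> equal to the steepness \<open>Suc n\<close>, the
    resolvent error is at most \<open>2 / sqrt (Suc n)\<close> and the subtracted exponential has
    norm at most \<open>1 / sqrt (Suc n)\<close>.\<close>
  have "\<exists>v h. (v, h) \<in> H \<and> inner h v \<le> 4 \<and> norm (w - v) \<le> 3 / sqrt (real (Suc n))" for n
  proof -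
    let ?m = "real (Suc n)"
    have m: "?m > 0" by simp
    obtain q where q1: "has_weak_deriv (w - right_exp (of_real ?m)) q"
      and q2: "Re (LINT x|lborel. of_real (c x) * rep_L2 q x * cnj (rep_L2 q x)) \<le> 4"
      using right_exp_difference_energy[OF _ c, of ?m] unfolding w_def by auto
    obtain v h where v: "(v, h) \<in> H" "inner h v \<le> 4" and d: "?m * (norm (w - right_exp (of_real ?m) - v))\<^sup>2 \<le> 4"
      using viscosity_approximation[OF c(1-3) H q1 q2 m] by blast
    have "norm (w - right_exp (of_real ?m) - v) \<le> 2 / sqrt ?m"
      by (rule power2_le_imp_le) (use d m in \<open>simp_all add: power_divide pos_le_divide_eq mult.commute\<close>)
    moreover have "norm (right_exp (of_real ?m)) \<le> 1 / sqrt ?m"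
      by (rule power2_le_imp_le)
         (use m in \<open>simp_all only: norm_right_exp[OF m] power_divide real_sqrt_pow2 less_imp_le\<close>, simp_all add: divide_simps)
    moreover have "norm (w - v) \<le> norm (w - right_exp (of_real ?m) - v) + norm (right_exp (of_real ?m))"
      using norm_triangle_ineq[of "w - right_exp (of_real ?m) - v" "right_exp (of_real ?m)"] by simp
    moreover have "2 / sqrt ?m + 1 / sqrt ?m = 3 / sqrt ?m" by (simp flip: add_divide_distrib)
    ultimately have "norm (w - v) \<le> 3 / sqrt ?m" by linarith
    with v show ?thesis by blast
  qed
  then obtain v h where vh: "\<And>n. (v n, h n) \<in> H" and hv: "\<And>n. inner (h n) (v n) \<le> 4"
    and dist: "\<And>n. norm (w - v n) \<le> 3 / sqrt (real (Suc n))" by metis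
  have lim: "v \<longlonglongrightarrow> w"
  proof (rule Lim_transform2[OF tendsto_const], rule tendsto_norm_zero_cancel, rule Lim_null_comparison)
    show "\<forall>\<^sub>F n in sequentially. norm (norm (w - v n)) \<le> 3 * sqrt (inverse (real (Suc n)))"
      using dist by (simp add: real_sqrt_inverse divide_inverse)
    have "(\<lambda>n. 3 * sqrt (inverse (real (Suc n)))) \<longlonglongrightarrow> 3 * sqrt 0"
      by (intro tendsto_intros LIMSEQ_inverse_real_of_nat)
    then show "(\<lambda>n. 3 * sqrt (inverse (real (Suc n)))) \<longlonglongrightarrow> 0" by simp
  qed
  have "Bseq v" using lim by (intro convergent_imp_Bseq convergentI)
  then obtain K where K: "\<And>n. norm (v n) \<le> K" by (auto simp: Bseq_def)
  have "\<exists>g. (v n, g) \<in> T \<and> (norm g)\<^sup>2 \<le> (4 * K\<^sup>2 + 16 + \<nu> * K\<^sup>2) / \<mu>" for n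
  proof -
    obtain f where f: "(v n, f) \<in> S" "(norm f)\<^sup>2 \<le> 4 * (norm (v n))\<^sup>2 + 4 * inner (h n) (v n)"
      using E.sqrt_oper_bound[OF E(2,3) _ vh] H
      unfolding is_viscosity_oper_def positive_self_adjoint_def inner_L2_def by blast
    obtain g where g: "(v n, g) \<in> T" using f dom by blast
    have K2: "(norm (v n))\<^sup>2 \<le> K\<^sup>2" using K by (intro power_mono) auto
    have "\<mu> * (norm g)\<^sup>2 \<le> (norm f)\<^sup>2 + \<nu> * (norm (v n))\<^sup>2" by (rule sub[OF f(1) g])
    also have "\<dots> \<le> (4 * K\<^sup>2 + 16) + \<nu> * K\<^sup>2"
      using f(2) hv[of n] K2 \<mu> by (intro add_mono mult_left_mono) auto
    finally show ?thesis using g \<mu> by (auto simp: pos_le_divide_eq mult.commute)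
  qed
  then obtain g C where vg: "\<And>n. (v n, g n) \<in> T" and g: "\<And>n. (norm (g n))\<^sup>2 \<le> C" by metis
  \<comment> \<open>Since \<open>(1 + \<i>)\<^sup>2 = 2 * \<i>\<close>, \<open>?k j\<close> is the
    square root with positive real part of the imaginary shift sampled in the weighted sum.\<close>
  let ?k = "\<lambda>j. of_real (2 ^ j) * (1 + \<i>)"
  have k2: "(?k j)\<^sup>2 = \<i> * of_real (2 * 4 ^ j)" for j
  proof -
    have "(of_real (2 ^ j) :: complex)\<^sup>2 = of_real (4 ^ j)"
    proof -
      have "(2 ^ j)\<^sup>2 = (4 ^ j :: real)" by (simp add: power2_eq_square flip: power_mult_distrib)
      then show ?thesis by (simp only: of_real_power[symmetric])
    qed
    then show ?thesis by (simp add: power_mult_distrib power2_eq_square algebra_simps)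
  qed
  have "\<exists>x. (x, w - cscale ((?k j)\<^sup>2) x) \<in> Laplacian \<and> cinner (w - cscale ((?k j)\<^sup>2) x) w = 1 / (2 * (1 + ?k j))" for j
  proof -
    have "(?k j)\<^sup>2 \<noteq> 1" unfolding k2 by (simp add: complex_eq_iff)
    moreover have "Re (?k j) > 0" by simp
    ultimately show ?thesis unfolding w_def by (metis Laplacian_resolvent_right_exp)
  qed
  then obtain x where x: "\<And>j. (x j, w - cscale ((?k j)\<^sup>2) (x j)) \<in> Laplacian"
    and xw: "\<And>j. cinner (w - cscale ((?k j)\<^sup>2) (x j)) w = 1 / (2 * (1 + ?k j))" by metis
  have "real N / 6 \<le> 4 * ((norm w)\<^sup>2 + C)" for N
  proof -
    \<comment> \<open>The logarithmic divergence in discrete form: \<open>cmod (1 + ?k j)\<close> is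
      at most \<open>3 * 2 ^ j\<close>, so every sample contributes at least 1/6.\<close>
    have "1 / 6 \<le> 2 ^ j * cmod (cinner (w - cscale ((?k j)\<^sup>2) (x j)) w)" for j
    proof -
      have "cmod (1 + \<i>) \<le> 2" using norm_triangle_ineq[of 1 \<i>] by simp
      then have "cmod (?k j) \<le> 2 ^ j * 2" by (simp add: norm_mult norm_power)
      then have "cmod (1 + ?k j) \<le> 1 + 2 ^ j * 2" using norm_triangle_ineq[of 1 "?k j"] by simp
      also have "\<dots> \<le> 3 * 2 ^ j" using one_le_power[of "2::real" j] by simp
      finally have le: "cmod (1 + ?k j) \<le> 3 * 2 ^ j" .
      have "Re (1 + ?k j) > 0" by (simp add: add_pos_pos)
      then have "1 + ?k j \<noteq> 0" by (metis less_irrefl zero_complex.sel(1))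
      then have pos: "cmod (1 + ?k j) > 0" by simp
      have "(2::real) ^ j > 0" by simp
      then have "1 / 6 \<le> 2 ^ j / (2 * cmod (1 + ?k j))"
        using le pos by (simp add: pos_le_divide_eq)
      then show ?thesis
        unfolding xw norm_divide norm_mult norm_one norm_numeral
        by (simp only: times_divide_eq_right mult_1_right)
    qed
    then have "(\<Sum>j<N. 1 / 6) \<le> (\<Sum>j<N. 2 ^ j * cmod (cinner (w - cscale ((?k j)\<^sup>2) (x j)) w))"
      by (rule sum_mono)
    also have "\<dots> \<le> 4 * ((norm w)\<^sup>2 + C)"
      by (rule G.weighted_resolvent_sum_bounded[OF G(2,3) vg g lim x]) (simp only: k2 diff_add_cancel)
    finally show ?thesis by simp
  qed
  moreover obtain N where "6 * (4 * ((norm w)\<^sup>2 + C)) < real N" using reals_Archimedean2 by blast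
  ultimately show False by (metis divide_le_eq_numeral1(1) linorder_not_le mult.commute)
qed

section \<open>The distance\<close>

text \<open>\<open>2 * L * sqrt t - s * f t\<close> is increasing for both signs \<open>s\<close>,
  and the square root is subadditive. The derivative test on the open interval admits
  \<open>p = 0\<close>, where \<open>sqrt\<close> is not differentiable.\<close>

lemma increment_le_if_deriv_le_inverse_sqrt:
  fixes f f' :: "real \<Rightarrow> real"
  assumes f: "\<And>t. (f has_real_derivative f' t) (at t)"
    and f': "\<And>t. p < t \<Longrightarrow> t < q \<Longrightarrow> \<bar>f' t\<bar> \<le> L / sqrt t" and pq: "0 \<le> p" "p \<le> q" and L: "L \<ge> 0"
  shows "\<bar>f q - f p\<bar> \<le> 2 * L * sqrt (q - p)"
proof -
  have "s * f q - s * f p \<le> 2 * L * sqrt (q - p)" if s: "\<bar>s\<bar> = 1" for s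
  proof -
    let ?g = "\<lambda>t. 2 * L * sqrt t - s * f t"
    have "?g p \<le> ?g q"
    proof (rule DERIV_nonneg_imp_increasing_open[OF pq(2)])
      fix t assume t: "p < t" "t < q"
      have "2 * L * (inverse (sqrt t) / 2) = L / sqrt t" by (simp add: inverse_eq_divide)
      moreover have "t > 0" using t pq by linarith
      ultimately have "(?g has_real_derivative L / sqrt t - s * f' t) (at t)"
        using DERIV_diff[OF DERIV_cmult[OF DERIV_real_sqrt[of t], of "2 * L"] DERIV_cmult[OF f, of s]]
        by simp
      moreover have "s * f' t \<le> \<bar>f' t\<bar>" using abs_ge_self[of "s * f' t"] s by (simp add: abs_mult)
      moreover have "\<bar>f' t\<bar> \<le> L / sqrt t" using t by (rule f')
      ultimately show "\<exists>y. (?g has_real_derivative y) (at t) \<and> 0 \<le> y" by force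
    next
      have "continuous_on {p..q} f"
        by (meson f DERIV_continuous_on has_field_derivative_at_within)
      then show "continuous_on {p..q} ?g" by (intro continuous_intros)
    qed
    moreover have "sqrt q \<le> sqrt p + sqrt (q - p)"
      using sqrt_add_le_add_sqrt[of p "q - p"] pq by simp
    then have "2 * L * sqrt q \<le> 2 * L * (sqrt p + sqrt (q - p))" using L by (intro mult_left_mono) auto
    ultimately show ?thesis by (simp add: distrib_left)
  qed
  from this[of 1] this[of "-1"] show ?thesis by auto
qed

text \<open>Reflection treats the left half-line, and an interval across 0 is split there, which
  doubles the constant. The point \<open>t = 0\<close> is exempt because \<open>L / sqrt 0\<close>
  is 0 and the bound would force the derivative to vanish.\<close>

lemma increment_le_if_deriv_le_inverse_sqrt_abs:
  fixes f f' :: "real \<Rightarrow> real"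
  assumes f: "\<And>t. (f has_real_derivative f' t) (at t)"
    and f': "\<And>t. t \<noteq> 0 \<Longrightarrow> p < t \<Longrightarrow> t < q \<Longrightarrow> \<bar>f' t\<bar> \<le> L / sqrt \<bar>t\<bar>" and pq: "p \<le> q" and L: "L \<ge> 0"
  shows "\<bar>f q - f p\<bar> \<le> 4 * L * sqrt (q - p)"
proof -
  have right: "\<bar>f b - f a\<bar> \<le> 2 * L * sqrt (q - p)" if "0 \<le> a" "a \<le> b" "p \<le> a" "b \<le> q" for a b
  proof -
    have "\<bar>f b - f a\<bar> \<le> 2 * L * sqrt (b - a)"
    proof (rule increment_le_if_deriv_le_inverse_sqrt[OF f _ that(1,2) L])
      fix t assume "a < t" "t < b"
      then show "\<bar>f' t\<bar> \<le> L / sqrt t" using f'[of t] that by simp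
    qed
    also have "\<dots> \<le> 2 * L * sqrt (q - p)" using that L by (intro mult_left_mono) auto
    finally show ?thesis .
  qed
  have left: "\<bar>f b - f a\<bar> \<le> 2 * L * sqrt (q - p)" if "b \<le> 0" "a \<le> b" "p \<le> a" "b \<le> q" for a b
  proof -
    have "((\<lambda>t. f (- t)) has_real_derivative - f' (- t)) (at t)" for t
      using DERIV_chain2[OF f[of "- t"] DERIV_minus[OF DERIV_ident]] by simp
    then have "\<bar>f (- (- a)) - f (- (- b))\<bar> \<le> 2 * L * sqrt (- a - - b)"
    proof (rule increment_le_if_deriv_le_inverse_sqrt[OF _ _ _ _ L])
      fix t assume "- b < t" "t < - a"
      then show "\<bar>- f' (- t)\<bar> \<le> L / sqrt t" using f'[of "- t"] that by simp
    qed (use that in auto)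
    also have "\<dots> \<le> 2 * L * sqrt (q - p)" using that L by (intro mult_left_mono) auto
    finally show ?thesis by (simp add: abs_minus_commute)
  qed
  have "0 \<le> 2 * L * sqrt (q - p)" using L pq by simp
  moreover consider "0 \<le> p" | "q \<le> 0" | "p \<le> 0" "0 \<le> q" by linarith
  then have "\<bar>f q - f p\<bar> \<le> 2 * (2 * L * sqrt (q - p)) \<or> \<bar>f q - f p\<bar> \<le> 2 * L * sqrt (q - p)"
  proof cases
    case 3
    then show ?thesis using right[of 0 q] left[of 0 p] by linarith
  qed (use right[of p q] left[of q p] pq in auto)
  ultimately show ?thesis by linarith
qed

text \<open>The set where the bound fails is open, so if nonempty it has positive measure.\<close>

lemma AE_imp_all_of_continuous:
  fixes g :: "real \<Rightarrow> real"
  assumes g: "continuous_on UNIV g" and AE: "AE x in lborel. g x \<le> K"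
  shows "g x \<le> K"
proof (rule ccontr)
  assume "\<not> g x \<le> K"
  have "open (g -` {K<..})" using g by (intro open_vimage) auto
  moreover have "x \<in> g -` {K<..}" using \<open>\<not> g x \<le> K\<close> by simp
  ultimately obtain e where e: "e > 0" "ball x e \<subseteq> g -` {K<..}" by (meson openE)
  have "AE y in lborel. y \<notin> ball x e" using AE e(2) by (auto elim!: eventually_mono)
  then have "emeasure lborel (ball x e) = 0" by (subst (asm) AE_iff_null_sets[symmetric]) auto
  moreover have "ball x e = {x - e<..<x + e}" by (auto simp: dist_real_def)
  ultimately show False using e(1) by simp
qed

lemma d_C_Holder:
  fixes c :: "real \<Rightarrow> real"
  assumes c: "continuous_on UNIV c" and ge: "\<And>t. \<bar>t\<bar> \<le> (1 + \<bar>t\<bar>) * c t" and xy: "\<bar>x - y\<bar> < 1"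
  shows "d_C c x y \<le> ennreal (4 * (2 + \<bar>x\<bar>) * \<bar>x - y\<bar> powr (1/2))"
  unfolding d_C_def
proof (rule SUP_least, safe)
  fix \<psi> assume \<psi>: "test_fun \<psi>" and AE: "AE t in lborel. \<bar>c t * (deriv \<psi> t)\<^sup>2\<bar> \<le> 1"
  \<comment> \<open>Between \<open>x\<close> and \<open>y\<close> one has
    \<open>\<bar>t\<bar> \<le> 1 + \<bar>x\<bar>\<close>, so \<open>L\<close> bounds
    \<open>1 + \<bar>t\<bar>\<close>; as \<open>L\<close> is at least 1, it may be weakened to its
    square, which keeps the final constant linear in \<open>L\<close>.\<close>
  define L where "L = 2 + \<bar>x\<bar>"
  have le1: "c t * (deriv \<psi> t)\<^sup>2 \<le> 1" for t
  proof -
    have "continuous_on UNIV (\<lambda>t. \<bar>c t * (deriv \<psi> t)\<^sup>2\<bar>)"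
      by (intro continuous_intros c continuous_on_test_fun test_fun_deriv \<psi>)
    from AE_imp_all_of_continuous[OF this AE, of t] show ?thesis by simp
  qed
  have bound: "\<bar>deriv \<psi> t\<bar> \<le> L / sqrt \<bar>t\<bar>" if t: "t \<noteq> 0" "\<bar>t\<bar> \<le> 1 + \<bar>x\<bar>" for t
  proof (rule power2_le_imp_le)
    have "\<bar>t\<bar> * (deriv \<psi> t)\<^sup>2 \<le> (1 + \<bar>t\<bar>) * c t * (deriv \<psi> t)\<^sup>2" by (intro mult_right_mono ge) simp
    also have "\<dots> \<le> (1 + \<bar>t\<bar>) * 1" unfolding mult.assoc by (intro mult_left_mono le1) simp
    also have "\<dots> \<le> L" using t by (simp add: L_def)
    also have "\<dots> \<le> L\<^sup>2" by (rule self_le_power) (simp_all add: L_def)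
    finally have "(deriv \<psi> t)\<^sup>2 \<le> L\<^sup>2 / \<bar>t\<bar>" using t by (simp add: pos_le_divide_eq mult.commute)
    then show "\<bar>deriv \<psi> t\<bar>\<^sup>2 \<le> (L / sqrt \<bar>t\<bar>)\<^sup>2" by (simp add: power_divide)
    show "0 \<le> L / sqrt \<bar>t\<bar>" by (simp add: L_def)
  qed
  have "\<bar>\<psi> (max x y) - \<psi> (min x y)\<bar> \<le> 4 * L * sqrt (max x y - min x y)"
    by (rule increment_le_if_deriv_le_inverse_sqrt_abs[OF test_fun_DERIV[OF \<psi>] bound])
       (use xy in \<open>auto simp: L_def\<close>)
  then have "\<bar>\<psi> x - \<psi> y\<bar> \<le> 4 * L * sqrt \<bar>x - y\<bar>"
    by (cases "x \<le> y") (auto simp: max_def min_def abs_minus_commute)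
  then show "ennreal \<bar>\<psi> x - \<psi> y\<bar> \<le> ennreal (4 * (2 + \<bar>x\<bar>) * \<bar>x - y\<bar> powr (1/2))"
    by (intro ennreal_leI) (simp add: L_def powr_half_sqrt)
qed

theorem mainTheorem8:
  fixes c :: "real \<Rightarrow> real" and H\<^sub>0 :: oper
  assumes "\<And>x. c x = (\<bar>x\<bar>\<^sup>2 / (1 + \<bar>x\<bar>\<^sup>2)) powr (1/2)"
    and "is_viscosity_oper c H\<^sub>0"
  shows "(\<forall>x. \<exists>a>0. \<forall>y. \<bar>x - y\<bar> < 1 \<longrightarrow> d_C c x y \<le> ennreal (a * \<bar>x - y\<bar> powr (1/2)))
    \<and> \<not> subelliptic (1/2) H\<^sub>0"
proof -
  have pos: "0 < 1 + x\<^sup>2" for x :: real by (rule add_pos_nonneg) auto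
  have c: "c x = \<bar>x\<bar> / sqrt (1 + x\<^sup>2)" for x
    using assms(1)[of x] pos[of x] by (simp add: powr_half_sqrt real_sqrt_divide)
  have nz: "sqrt (1 + x\<^sup>2) > 0" for x using pos[of x] by simp
  have cont: "continuous_on UNIV c"
    unfolding c[abs_def] by (intro continuous_intros) (use nz in \<open>simp add: less_imp_neq[symmetric]\<close>)
  \<comment> \<open>These bounds give \<open>c x \<le> 1\<close> and
    \<open>c x \<le> \<bar>x\<bar>\<close> for the energy; \<open>sqrt_le\<close> gives the lower
    bound on \<open>c\<close> that controls the distance.\<close>
  have sqrt_ge: "1 \<le> sqrt (1 + x\<^sup>2)" "\<bar>x\<bar> \<le> sqrt (1 + x\<^sup>2)" for x
    by (auto intro: real_le_rsqrt)
  have sqrt_le: "sqrt (1 + x\<^sup>2) \<le> 1 + \<bar>x\<bar>" for x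
    by (rule real_le_lsqrt) (auto simp: power2_sum)
  have "\<bar>t\<bar> \<le> (1 + \<bar>t\<bar>) * c t" for t
  proof -
    have "\<bar>t\<bar> * sqrt (1 + t\<^sup>2) \<le> \<bar>t\<bar> * (1 + \<bar>t\<bar>)" using sqrt_le by (rule mult_left_mono) simp
    then show ?thesis using nz[of t] by (simp add: c pos_le_divide_eq mult.commute)
  qed
  then have "\<forall>x. \<exists>a>0. \<forall>y. \<bar>x - y\<bar> < 1 \<longrightarrow> d_C c x y \<le> ennreal (a * \<bar>x - y\<bar> powr (1/2))"
    using d_C_Holder[OF cont] by (intro allI exI[of _ "4 * (2 + \<bar>_\<bar>)"]) auto
  moreover have "\<not> subelliptic (1/2) H\<^sub>0"
  proof (rule not_subelliptic[OF _ _ _ _ assms(2)])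
    show "c \<in> borel_measurable borel" by (rule borel_measurable_continuous_onI[OF cont])
    show "0 \<le> c x" "c x \<le> 1" "c x \<le> \<bar>x\<bar>" for x
      using nz[of x] sqrt_ge[of x] mult_left_mono[OF sqrt_ge(1)[of x], of "\<bar>x\<bar>"]
      by (simp_all add: c pos_divide_le_eq)
  qed
  ultimately show ?thesis by blast
qed

end
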